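(* Let $D\ge 0$ be a diagonal matrix on $\ell^2(\mathbb Z)$ of trace class and let $J'$ be a self-adjoint (two-sided, bounded) Jacobi matrix. Let $E=\sigma(J')$. Then $$\bigl\|D^{1/2}(J'-x)^{-1}D^{1/2}\bigr\|_1\le \|D\|_1\,\sup_{n\in\mathbb Z}\int_E\frac{d\rho_n(t)}{|t-x|},\qquad x\in\mathbb R\setminus E,$$ where $d\rho_n$ is the spectral measure of $(J',\delta_n)$, that is, the measure from the Herglotz representation of the $n$th diagonal entry of the resolvent: $$\bigl\langle\delta_n,(J'-z)^{-1}\delta_n\bigr\rangle=\int_E\frac{d\rho_n(t)}{t-z},\qquad z\in\mathbb C\setminus E.$$
   Context: A two-sided Jacobi matrix is the operator on $\ell^2(\mathbb Z)$ given by the tridiagonal real symmetric matrix with bounded parameters $\{a_n,b_n\}_{n\in\mathbb Z}$, $a_n>0$, $b_n\in\mathbb R$, whose diagonal entries are $b_n$ and whose off-diagonal entries are the $a_n$. $\{\delta_n\}_{n\in\mathbb Z}$ is the standard basis of $\ell^2(\mathbb Z)$, and $\|\cdot\|_1$ denotes the trace norm. *)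

theory Defs
  imports "HOL-Analysis.Analysis"
begin

section \<open>The complex Hilbert space of square-summable families\<close>

typedef 'i ell2 = "{u :: 'i \<Rightarrow> complex. (\<lambda>i. (cmod (u i))\<^sup>2) summable_on UNIV}"
  morphisms coord Abs_ell2
  by (rule exI[of _ "\<lambda>_. 0"]) simp

setup_lifting type_definition_ell2

lemma square_summable_mult:
  fixes u v :: "'i \<Rightarrow> complex"
  assumes "(\<lambda>i. (cmod (u i))\<^sup>2) summable_on UNIV" and "(\<lambda>i. (cmod (v i))\<^sup>2) summable_on UNIV"
  shows "(\<lambda>i. cnj (u i) * v i) summable_on UNIV"
proof -
  have "(\<lambda>i. (cmod (u i))\<^sup>2 + (cmod (v i))\<^sup>2) summable_on UNIV"
    using assms by (rule summable_on_add)
  moreover have "norm (cnj (u i) * v i) \<le> (cmod (u i))\<^sup>2 + (cmod (v i))\<^sup>2" for i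
  proof -
    have "2 * (cmod (u i) * cmod (v i)) \<le> (cmod (u i))\<^sup>2 + (cmod (v i))\<^sup>2"
      using sum_squares_bound[of "cmod (u i)" "cmod (v i)"] by simp
    moreover have "0 \<le> cmod (u i) * cmod (v i)" by simp
    ultimately have "cmod (u i) * cmod (v i) \<le> (cmod (u i))\<^sup>2 + (cmod (v i))\<^sup>2" by linarith
    then show ?thesis by (simp add: norm_mult)
  qed
  ultimately have "(\<lambda>i. norm (cnj (u i) * v i)) summable_on UNIV"
    by (rule summable_on_comparison_test) auto
  then show ?thesis by (rule abs_summable_summable)
qed

lemma square_summable_add:
  fixes u v :: "'i \<Rightarrow> complex"
  assumes "(\<lambda>i. (cmod (u i))\<^sup>2) summable_on UNIV" and "(\<lambda>i. (cmod (v i))\<^sup>2) summable_on UNIV"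
  shows "(\<lambda>i. (cmod (u i + v i))\<^sup>2) summable_on UNIV"
proof (rule summable_on_comparison_test)
  show "(\<lambda>i. 2 * (cmod (u i))\<^sup>2 + 2 * (cmod (v i))\<^sup>2) summable_on UNIV"
    by (intro summable_on_add summable_on_cmult_right assms)
next
  fix i
  have "(cmod (u i + v i))\<^sup>2 \<le> (cmod (u i) + cmod (v i))\<^sup>2"
    by (intro power_mono norm_triangle_ineq) auto
  also have "\<dots> \<le> 2 * (cmod (u i))\<^sup>2 + 2 * (cmod (v i))\<^sup>2"
    using sum_squares_bound[of "cmod (u i)" "cmod (v i)"] by (simp add: power2_sum)
  finally show "(cmod (u i + v i))\<^sup>2 \<le> 2 * (cmod (u i))\<^sup>2 + 2 * (cmod (v i))\<^sup>2" .
qed auto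

lemma square_summable_cmult:
  fixes u :: "'i \<Rightarrow> complex"
  assumes "(\<lambda>i. (cmod (u i))\<^sup>2) summable_on UNIV"
  shows "(\<lambda>i. (cmod (c * u i))\<^sup>2) summable_on UNIV"
  using summable_on_cmult_right[OF assms, of "(cmod c)\<^sup>2"]
  by (simp add: norm_mult power_mult_distrib)

lemma square_summable_coord: "(\<lambda>i. (cmod (coord u i))\<^sup>2) summable_on UNIV"
  using coord[of u] by simp

lift_definition scaleC :: "complex \<Rightarrow> 'i ell2 \<Rightarrow> 'i ell2"  (infixr \<open>*\<^sub>C\<close> 75)
  is "\<lambda>c u i. c * u i"
  by (rule square_summable_cmult)

definition cinner :: "'i ell2 \<Rightarrow> 'i ell2 \<Rightarrow> complex" where
  "cinner u v = (\<Sum>\<^sub>\<infinity>i. cnj (coord u i) * coord v i)"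

lift_definition delta :: "'i \<Rightarrow> 'i ell2"
  is "\<lambda>n i. if i = n then 1 else 0"
proof -
  fix n :: 'i
  have "(\<lambda>i. (cmod (if i = n then 1 else 0))\<^sup>2) summable_on {n}" by simp
  then show "(\<lambda>i. (cmod (if i = n then 1 else 0))\<^sup>2) summable_on UNIV"
    by (rule summable_on_cong_neutral[THEN iffD1, rotated -1]) auto
qed

instantiation ell2 :: (type) real_vector
begin
lift_definition zero_ell2 :: "'a ell2" is "\<lambda>_. 0" by simp
lift_definition plus_ell2 :: "'a ell2 \<Rightarrow> 'a ell2 \<Rightarrow> 'a ell2" is "\<lambda>u v i. u i + v i"
  by (rule square_summable_add)
lift_definition uminus_ell2 :: "'a ell2 \<Rightarrow> 'a ell2" is "\<lambda>u i. - u i" by simp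
lift_definition minus_ell2 :: "'a ell2 \<Rightarrow> 'a ell2 \<Rightarrow> 'a ell2" is "\<lambda>u v i. u i - v i"
  subgoal for u v using square_summable_add[of u "\<lambda>i. - v i"] by simp
  done
lift_definition scaleR_ell2 :: "real \<Rightarrow> 'a ell2 \<Rightarrow> 'a ell2" is "\<lambda>r u i. complex_of_real r * u i"
  by (rule square_summable_cmult)
instance
  by standard (transfer; force simp: algebra_simps)+
end

instantiation ell2 :: (type) real_inner
begin

text \<open>The norm and the topology are those of the complex inner product; the class only asks
  for a real one, for which we take the real part.\<close>
definition inner_ell2 :: "'a ell2 \<Rightarrow> 'a ell2 \<Rightarrow> real" where
  "inner_ell2 u v = Re (cinner u v)"
definition norm_ell2 :: "'a ell2 \<Rightarrow> real" where
  "norm_ell2 u = sqrt (inner u u)"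
definition sgn_ell2 :: "'a ell2 \<Rightarrow> 'a ell2" where
  "sgn_ell2 u = u /\<^sub>R norm u"
definition dist_ell2 :: "'a ell2 \<Rightarrow> 'a ell2 \<Rightarrow> real" where
  "dist_ell2 u v = norm (u - v)"
definition uniformity_ell2 :: "('a ell2 \<times> 'a ell2) filter" where
  "uniformity_ell2 = (INF e\<in>{0<..}. principal {(u, v). dist u v < e})"
definition open_ell2 :: "'a ell2 set \<Rightarrow> bool" where
  "open_ell2 U \<longleftrightarrow> (\<forall>u\<in>U. \<forall>\<^sub>F (u', v) in uniformity. u' = u \<longrightarrow> v \<in> U)"

instance
proof
  fix u v w :: "'a ell2" and r :: real
  note summ = square_summable_mult[OF square_summable_coord square_summable_coord]
  have self: "inner u u = (\<Sum>\<^sub>\<infinity>i. (cmod (coord u i))\<^sup>2)"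
    unfolding inner_ell2_def cinner_def infsum_Re[OF summ, symmetric]
    by (simp add: cmod_power2 flip: power2_eq_square)
  show "dist u v = norm (u - v)" by (rule dist_ell2_def)
  show "sgn u = u /\<^sub>R norm u" by (rule sgn_ell2_def)
  show "uniformity = (INF e\<in>{0<..}. principal {(u :: 'a ell2, v). dist u v < e})"
    by (rule uniformity_ell2_def)
  show "open U \<longleftrightarrow> (\<forall>u\<in>U. \<forall>\<^sub>F (u', v) in uniformity. u' = u \<longrightarrow> v \<in> U)" for U :: "'a ell2 set"
    by (rule open_ell2_def)
  have "cinner v u = cnj (cinner u v)"
    unfolding cinner_def infsum_cnj[symmetric] by (simp add: mult.commute)
  then show "inner u v = inner v u" by (simp add: inner_ell2_def)
  show "inner (u + v) w = inner u w + inner v w"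
    by (simp add: inner_ell2_def cinner_def plus_ell2.rep_eq distrib_right infsum_add summ)
  have "cinner (r *\<^sub>R u) v = of_real r * cinner u v"
    by (simp add: cinner_def scaleR_ell2.rep_eq mult.assoc infsum_cmult_right')
  then show "inner (r *\<^sub>R u) v = r * inner u v" by (simp add: inner_ell2_def)
  show "0 \<le> inner u u" unfolding self by (intro infsum_nonneg) auto
  show "inner u u = 0 \<longleftrightarrow> u = 0"
  proof
    assume "inner u u = 0"
    then have "(cmod (coord u i))\<^sup>2 = 0" for i
      unfolding self by (intro nonneg_infsum_le_0D[OF _ square_summable_coord]) auto
    then show "u = 0" by (simp add: coord_inject[symmetric] zero_ell2.rep_eq fun_eq_iff)
  qed (simp add: inner_ell2_def cinner_def zero_ell2.rep_eq)
  show "norm u = sqrt (inner u u)" by (rule norm_ell2_def)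
qed
end

section \<open>Bounded operators\<close>

definition bounded_clinear :: "('i ell2 \<Rightarrow> 'i ell2) \<Rightarrow> bool" where
  "bounded_clinear A \<longleftrightarrow> bounded_linear A \<and> (\<forall>c u. A (c *\<^sub>C u) = c *\<^sub>C A u)"

definition cadjoint :: "('i ell2 \<Rightarrow> 'i ell2) \<Rightarrow> 'i ell2 \<Rightarrow> 'i ell2" where
  "cadjoint A = (THE B. bounded_clinear B \<and> (\<forall>u v. cinner (A u) v = cinner u (B v)))"

definition selfadjoint_op :: "('i ell2 \<Rightarrow> 'i ell2) \<Rightarrow> bool" where
  "selfadjoint_op A \<longleftrightarrow> bounded_clinear A \<and> cadjoint A = A"

definition positive_op :: "('i ell2 \<Rightarrow> 'i ell2) \<Rightarrow> bool" where
  "positive_op A \<longleftrightarrow> bounded_clinear A \<and> (\<forall>u. cinner u (A u) \<in> \<real>\<^sub>\<ge>\<^sub>0)"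

definition sqrt_op :: "('i ell2 \<Rightarrow> 'i ell2) \<Rightarrow> 'i ell2 \<Rightarrow> 'i ell2" where
  "sqrt_op A = (THE B. positive_op B \<and> B \<circ> B = A)"

definition abs_op :: "('i ell2 \<Rightarrow> 'i ell2) \<Rightarrow> 'i ell2 \<Rightarrow> 'i ell2" where
  "abs_op A = sqrt_op (cadjoint A \<circ> A)"

text \<open>The trace of the positive operator \<open>\<bar>A\<bar>\<close>, computed in the standard basis; it is \<open>\<infinity>\<close>
  when the bounded operator \<open>A\<close> is not of trace class.\<close>
definition trace_norm :: "('i ell2 \<Rightarrow> 'i ell2) \<Rightarrow> ennreal" where
  "trace_norm A = (\<Sum>\<^sub>\<infinity>n. ennreal (Re (cinner (delta n) (abs_op A (delta n)))))"

definition trace_class :: "('i ell2 \<Rightarrow> 'i ell2) \<Rightarrow> bool" where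
  "trace_class A \<longleftrightarrow> bounded_clinear A \<and> trace_norm A < \<infinity>"

definition diagonal_op :: "('i ell2 \<Rightarrow> 'i ell2) \<Rightarrow> bool" where
  "diagonal_op A \<longleftrightarrow> (\<forall>m n. m \<noteq> n \<longrightarrow> cinner (delta m) (A (delta n)) = 0)"

definition resolvent :: "('i ell2 \<Rightarrow> 'i ell2) \<Rightarrow> complex \<Rightarrow> 'i ell2 \<Rightarrow> 'i ell2" where
  "resolvent A z = inv (\<lambda>u. A u - z *\<^sub>C u)"

definition spectrum :: "('i ell2 \<Rightarrow> 'i ell2) \<Rightarrow> complex set" where
  "spectrum A = {z. \<not> (bij (\<lambda>u. A u - z *\<^sub>C u) \<and> bounded_clinear (resolvent A z))}"

text \<open>The spectrum of a self-adjoint operator as a subset of the real line, which contains it.\<close>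
definition real_spectrum :: "('i ell2 \<Rightarrow> 'i ell2) \<Rightarrow> real set" where
  "real_spectrum A = {t. complex_of_real t \<in> spectrum A}"

section \<open>Jacobi matrices and spectral measures\<close>

text \<open>Indexing convention: \<open>a n\<close> is the entry at the positions \<open>(n, n + 1)\<close> and \<open>(n + 1, n)\<close>.
  The value is meaningful for bounded parameters, see \<open>coord_jacobi\<close> below.\<close>
definition jacobi :: "(int \<Rightarrow> real) \<Rightarrow> (int \<Rightarrow> real) \<Rightarrow> int ell2 \<Rightarrow> int ell2" where
  "jacobi a b u = Abs_ell2 (\<lambda>n. of_real (a (n - 1)) * coord u (n - 1)
                              + of_real (b n) * coord u n
                              + of_real (a n) * coord u (n + 1))"

lemma square_summable_bounded_mult:
  fixes u :: "'i \<Rightarrow> complex" and c :: "'i \<Rightarrow> real"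
  assumes "bounded (range c)" and u: "(\<lambda>i. (cmod (u i))\<^sup>2) summable_on UNIV"
  shows "(\<lambda>i. (cmod (of_real (c i) * u i))\<^sup>2) summable_on UNIV"
proof -
  obtain B where B: "\<And>i. \<bar>c i\<bar> \<le> B"
    using assms(1) by (auto simp: bounded_iff)
  show ?thesis
  proof (rule summable_on_comparison_test)
    show "(\<lambda>i. B\<^sup>2 * (cmod (u i))\<^sup>2) summable_on UNIV"
      by (intro summable_on_cmult_right u)
    show "(cmod (of_real (c i) * u i))\<^sup>2 \<le> B\<^sup>2 * (cmod (u i))\<^sup>2" for i
      using power_mono[OF B[of i] abs_ge_zero, of 2]
      by (simp add: norm_mult power_mult_distrib mult_right_mono)
  qed auto
qed

lemma square_summable_shift:
  fixes u :: "int \<Rightarrow> complex"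
  assumes "(\<lambda>n. (cmod (u n))\<^sup>2) summable_on UNIV"
  shows "(\<lambda>n. (cmod (u (n + k)))\<^sup>2) summable_on UNIV"
proof -
  have "bij (\<lambda>n :: int. n + k)"
    by (rule bij_betw_byWitness[where f' = "\<lambda>n. n - k"]) auto
  from summable_on_reindex_bij_betw[OF this, of "\<lambda>n. (cmod (u n))\<^sup>2"] assms
  show ?thesis by simp
qed

lemma coord_jacobi:
  assumes "bounded (range a)" and "bounded (range b)"
  shows "coord (jacobi a b u) n = of_real (a (n - 1)) * coord u (n - 1)
                                + of_real (b n) * coord u n
                                + of_real (a n) * coord u (n + 1)"
proof -
  have "bounded (range (\<lambda>n. a (n - 1)))"
    by (rule bounded_subset[OF assms(1)]) auto
  moreover have "(\<lambda>n. (cmod (coord u (n - 1)))\<^sup>2) summable_on UNIV"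
    using square_summable_shift[OF square_summable_coord[of u], of "-1"] by simp
  ultimately have "(\<lambda>n. (cmod (of_real (a (n - 1)) * coord u (n - 1)
                      + of_real (b n) * coord u n
                      + of_real (a n) * coord u (n + 1)))\<^sup>2) summable_on UNIV"
    by (intro square_summable_add square_summable_bounded_mult square_summable_coord
        square_summable_shift assms)
  then show ?thesis
    unfolding jacobi_def by (subst Abs_ell2_inverse) auto
qed

text \<open>For self-adjoint \<open>J\<close>: \<open>\<rho>\<close> is the spectral measure of \<open>(J, \<delta>\<^sub>n)\<close>, the finite Borel measure
  on the spectrum in the Herglotz representation of the \<open>n\<close>th diagonal entry of the
  resolvent.\<close>
definition is_spectral_measure :: "('i ell2 \<Rightarrow> 'i ell2) \<Rightarrow> 'i \<Rightarrow> real measure \<Rightarrow> bool" where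
  "is_spectral_measure J n \<rho> \<longleftrightarrow>
     sets \<rho> = sets borel \<and> finite_measure \<rho> \<and> (AE t in \<rho>. t \<in> real_spectrum J) \<and>
     (\<forall>z. z \<notin> spectrum J \<longrightarrow>
        cinner (delta n) (resolvent J z (delta n)) =
          (LINT t:real_spectrum J|\<rho>. 1 / (complex_of_real t - z)))"

end

theory Submission
  imports Defs
begin

text \<open>Write \<open>R = (J - x)\<^sup>-\<^sup>1\<close>, \<open>S = D\<^sup>1\<^sup>/\<^sup>2\<close> and \<open>d\<^sub>n = \<langle>\<delta>\<^sub>n, D \<delta>\<^sub>n\<rangle>\<close>. The theorem follows from two
  facts about the modulus \<open>\<bar>R\<bar> = (R\<^sup>2)\<^sup>1\<^sup>/\<^sup>2\<close>. The trace norm of \<open>S R S\<close> is at most the trace of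
  \<open>S \<bar>R\<bar> S\<close>, which is \<open>\<Sum>\<^sub>n d\<^sub>n \<langle>\<delta>\<^sub>n, \<bar>R\<bar> \<delta>\<^sub>n\<rangle>\<close> because \<open>S \<delta>\<^sub>n\<close> is a multiple of \<open>\<delta>\<^sub>n\<close>; and
  \<open>\<langle>\<delta>\<^sub>n, \<bar>R\<bar> \<delta>\<^sub>n\<rangle>\<close> is at most the integral of \<open>1 / \<bar>t - x\<bar>\<close> with respect to \<open>\<rho>\<^sub>n\<close>.

  The first fact (\<open>trace_norm_sandwich_le\<close>) needs no spectral theorem. Put \<open>K = \<bar>R\<bar>\<^sup>1\<^sup>/\<^sup>2\<close>,
  \<open>A = S R S\<close> and, for \<open>\<epsilon> > 0\<close>, \<open>U = A (\<bar>A\<bar> + \<epsilon>)\<^sup>-\<^sup>1\<close>. This \<open>U\<close> is a contraction that stands in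
  for the partial isometry of the polar decomposition: \<open>A U \<ge> \<bar>A\<bar> - \<epsilon>\<close>. The same device applied
  to \<open>R\<close> gives \<open>\<langle>R u, v\<rangle> \<le> \<parallel>K u\<parallel> \<parallel>K v\<parallel>\<close> (\<open>op_abs_Cauchy_Schwarz\<close>). Hence
  \<open>\<langle>\<delta>\<^sub>n, \<bar>A\<bar> \<delta>\<^sub>n\<rangle> - \<epsilon> \<le> \<langle>R S \<delta>\<^sub>n, S U \<delta>\<^sub>n\<rangle> \<le> \<parallel>K S \<delta>\<^sub>n\<parallel> \<parallel>K S U \<delta>\<^sub>n\<parallel>\<close>, and the Hilbert--Schmidt norm of
  \<open>K S U\<close> does not exceed that of \<open>K S\<close>, since it is unchanged by taking adjoints.

  For the second fact (\<open>op_abs_resolvent_diag_le\<close>) the resolvent is expanded in powers of \<open>h\<close> at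
  the real points \<open>x + h\<close>. Comparing coefficients in the Herglotz representation gives
  \<open>\<langle>\<delta>\<^sub>n, R\<^sup>k \<delta>\<^sub>n\<rangle> = \<integral> (t - x)\<^sup>-\<^sup>k d\<rho>\<^sub>n(t)\<close> for \<open>k \<ge> 1\<close>, and \<open>\<bar>R\<bar>\<close> is a limit of polynomials in \<open>R\<^sup>2\<close>
  without constant term whose scalar counterparts stay below \<open>1 / \<bar>t - x\<bar>\<close>.

  Square roots are built from the binomial series of \<open>(1 - x)\<^sup>1\<^sup>/\<^sup>2\<close>, which converges absolutely on
  the closed unit ball of every Banach algebra. The bounded complex-linear operators are
  therefore made into a Banach algebra, which also supplies the Neumann series.\<close>

section \<open>The space of square-summable families is complete\<close>

lemma cinner_delta_left: "cinner (delta n) u = coord u n"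
proof -
  have "cinner (delta n) u = (\<Sum>\<^sub>\<infinity>i\<in>{n}. coord u i)"
    unfolding cinner_def by (rule infsum_cong_neutral) (auto simp: delta.rep_eq)
  then show ?thesis by simp
qed

lemma cinner_cnj: "cinner v u = cnj (cinner u v)"
  unfolding cinner_def infsum_cnj[symmetric] by (simp add: mult.commute)

lemma cinner_scaleC_left: "cinner (c *\<^sub>C u) v = cnj c * cinner u v"
  by (simp add: cinner_def scaleC.rep_eq mult.assoc infsum_cmult_right')

text \<open>The complex inner product can be recovered from the real one and multiplication by \<open>\<i>\<close>. Most
  arguments below can thus be carried out in the real inner product space.\<close>
lemma cinner_eq_inner: "cinner u v = Complex (inner u v) (inner (\<i> *\<^sub>C u) v)"
  by (simp add: inner_ell2_def complex_eq_iff cinner_scaleC_left)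

lemma scaleC_add_right: "c *\<^sub>C (u + v) = c *\<^sub>C u + c *\<^sub>C v"
  by transfer (simp add: algebra_simps)

lemma scaleC_of_real: "of_real r *\<^sub>C u = r *\<^sub>R u"
  by transfer simp

lemma scaleC_scaleR: "c *\<^sub>C (r *\<^sub>R u) = r *\<^sub>R (c *\<^sub>C u)"
  by transfer (simp add: algebra_simps)

lemma scaleC_scaleC: "c *\<^sub>C (d *\<^sub>C u) = (c * d) *\<^sub>C u"
  by transfer (simp add: algebra_simps)

lemma inner_eq_infsum: "inner u u = (\<Sum>\<^sub>\<infinity>i. (cmod (coord u i))\<^sup>2)"
  unfolding inner_ell2_def cinner_def
    infsum_Re[OF square_summable_mult[OF square_summable_coord square_summable_coord], symmetric]
  by (simp add: cmod_power2 flip: power2_eq_square)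

lemma norm_eq_infsum: "(norm u)\<^sup>2 = (\<Sum>\<^sub>\<infinity>i. (cmod (coord u i))\<^sup>2)"
  by (simp add: power2_norm_eq_inner inner_eq_infsum)

lemma sum_coord_le_norm:
  assumes "finite F"
  shows "(\<Sum>i\<in>F. (cmod (coord u i))\<^sup>2) \<le> (norm u)\<^sup>2"
  unfolding norm_eq_infsum
  by (rule finite_sum_le_infsum[OF square_summable_coord assms]) auto

lemma norm_coord_le: "cmod (coord u i) \<le> norm u"
  using sum_coord_le_norm[of "{i}" u] by (simp add: power2_le_iff_abs_le)

lemma norm_scaleC: "norm (c *\<^sub>C u) = cmod c * norm u"
proof -
  have "(norm (c *\<^sub>C u))\<^sup>2 = (cmod c * norm u)\<^sup>2"
    by (simp add: norm_eq_infsum scaleC.rep_eq norm_mult power_mult_distrib infsum_cmult_right')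
  then show ?thesis by (simp add: power2_eq_iff_nonneg)
qed

lemma norm_delta [simp]: "norm (delta n) = 1"
proof -
  have "cinner (delta n) (delta n) = 1"
    by (simp add: cinner_delta_left delta.rep_eq)
  then show ?thesis by (simp add: norm_ell2_def inner_ell2_def)
qed

lemma bounded_linear_scaleC: "bounded_linear (\<lambda>u. c *\<^sub>C u)"
  by (rule bounded_linear_intro[where K = "cmod c"])
     (simp_all add: scaleC_add_right scaleC_scaleR norm_scaleC mult.commute)

lemma scaleC_zero_right [simp]: "c *\<^sub>C 0 = 0"
  by transfer simp

lemma scaleC_diff_right: "c *\<^sub>C (u - v) = c *\<^sub>C u - c *\<^sub>C v"
  by transfer (simp add: algebra_simps)

lemma scaleC_minus_right: "c *\<^sub>C (- u) = - (c *\<^sub>C u)"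
  by transfer (simp add: algebra_simps)

lemma inner_scaleC_i: "inner (\<i> *\<^sub>C u) v = - inner u (\<i> *\<^sub>C v)"
proof -
  have "cinner u (\<i> *\<^sub>C v) = \<i> * cinner u v"
    using cinner_cnj[of u "\<i> *\<^sub>C v"] cinner_cnj[of u v] by (simp add: cinner_scaleC_left)
  then show ?thesis
    by (simp add: inner_ell2_def cinner_scaleC_left)
qed

text \<open>A Cauchy sequence converges coordinatewise. The limit is reached in norm because the bound
  on \<open>X m - X n\<close> restricts to finitely many coordinates, where \<open>n\<close> can be sent to infinity.\<close>
instance ell2 :: (type) banach
proof
  fix X :: "nat \<Rightarrow> 'a ell2"
  assume X: "Cauchy X"
  define x where "x i = lim (\<lambda>k. coord (X k) i)" for i
  have lim: "(\<lambda>k. coord (X k) i) \<longlonglongrightarrow> x i" for i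
  proof -
    have "Cauchy (\<lambda>k. coord (X k) i)"
      unfolding Cauchy_iff
    proof (intro allI impI)
      fix e :: real assume "e > 0"
      then obtain M where M: "\<And>m n. m \<ge> M \<Longrightarrow> n \<ge> M \<Longrightarrow> norm (X m - X n) < e"
        using X unfolding Cauchy_iff by metis
      have "cmod (coord (X m) i - coord (X n) i) \<le> norm (X m - X n)" for m n
        using norm_coord_le[of "X m - X n" i] by (simp add: minus_ell2.rep_eq)
      then show "\<exists>M. \<forall>m\<ge>M. \<forall>n\<ge>M. cmod (coord (X m) i - coord (X n) i) < e"
        using M by (meson le_less_trans)
    qed
    then show ?thesis
      unfolding x_def by (simp add: Cauchy_convergent_iff convergent_LIMSEQ_iff)
  qed
  have tail: "(\<Sum>i\<in>F. (cmod (coord (X m) i - x i))\<^sup>2) \<le> e\<^sup>2"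
    if "finite F" "\<And>n. n \<ge> M \<Longrightarrow> norm (X m - X n) \<le> e" for F m M e
  proof (rule tendsto_upperbound)
    show "(\<lambda>n. \<Sum>i\<in>F. (cmod (coord (X m) i - coord (X n) i))\<^sup>2)
            \<longlonglongrightarrow> (\<Sum>i\<in>F. (cmod (coord (X m) i - x i))\<^sup>2)"
      by (intro tendsto_intros lim)
    show "\<forall>\<^sub>F n in sequentially. (\<Sum>i\<in>F. (cmod (coord (X m) i - coord (X n) i))\<^sup>2) \<le> e\<^sup>2"
      using eventually_ge_at_top[of M]
    proof eventually_elim
      fix n assume "n \<ge> M"
      have "(\<Sum>i\<in>F. (cmod (coord (X m - X n) i))\<^sup>2) \<le> (norm (X m - X n))\<^sup>2"
        by (rule sum_coord_le_norm) fact
      also have "\<dots> \<le> e\<^sup>2"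
        using that(2)[OF \<open>n \<ge> M\<close>] by (simp add: power_mono)
      finally show "(\<Sum>i\<in>F. (cmod (coord (X m) i - coord (X n) i))\<^sup>2) \<le> e\<^sup>2"
        by (simp add: minus_ell2.rep_eq)
    qed
  qed simp
  have summ: "(\<lambda>i. (cmod (coord (X m) i - x i))\<^sup>2) summable_on UNIV"
    if "\<And>n. n \<ge> M \<Longrightarrow> norm (X m - X n) \<le> e" for m M e
    by (rule nonneg_bdd_above_summable_on) (auto intro!: bdd_aboveI[of _ "e\<^sup>2"] tail[OF _ that])
  obtain M0 where M0: "\<And>m n. m \<ge> M0 \<Longrightarrow> n \<ge> M0 \<Longrightarrow> norm (X m - X n) < 1"
    using X unfolding Cauchy_iff by (metis zero_less_one)
  have "(\<lambda>i. (cmod (coord (X M0) i - x i))\<^sup>2) summable_on UNIV"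
    by (rule summ[of M0 _ 1]) (use M0 in \<open>auto intro: less_imp_le\<close>)
  from square_summable_add[OF square_summable_coord[of "X M0"]
      square_summable_cmult[OF this, of "-1"]]
  have x: "(\<lambda>i. (cmod (x i))\<^sup>2) summable_on UNIV" by simp
  have coord_x: "coord (Abs_ell2 x) = x"
    using x by (simp add: Abs_ell2_inverse)
  have "X \<longlonglongrightarrow> Abs_ell2 x"
    unfolding LIMSEQ_def
  proof (intro allI impI)
    fix e :: real assume "e > 0"
    then have "e / 2 > 0" by simp
    then obtain M where M: "\<And>m n. m \<ge> M \<Longrightarrow> n \<ge> M \<Longrightarrow> norm (X m - X n) < e / 2"
      using X unfolding Cauchy_iff by metis
    have "dist (X m) (Abs_ell2 x) < e" if "m \<ge> M" for m
    proof -
      have b: "norm (X m - X n) \<le> e / 2" if "n \<ge> M" for n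
        using M[OF \<open>m \<ge> M\<close> that] by simp
      have "(norm (X m - Abs_ell2 x))\<^sup>2 = (\<Sum>\<^sub>\<infinity>i. (cmod (coord (X m) i - x i))\<^sup>2)"
        by (simp add: norm_eq_infsum minus_ell2.rep_eq coord_x)
      also have "\<dots> \<le> (e / 2)\<^sup>2"
        by (rule infsum_le_finite_sums[OF summ[OF b]]) (auto intro: tail[OF _ b])
      finally have "norm (X m - Abs_ell2 x) \<le> e / 2"
        using \<open>e > 0\<close> by (simp add: power2_le_iff_abs_le)
      then show ?thesis using \<open>e > 0\<close> by (simp add: dist_norm)
    qed
    then show "\<exists>M. \<forall>n\<ge>M. dist (X n) (Abs_ell2 x) < e" by blast
  qed
  then show "convergent X" by (auto simp: convergent_def)
qed

section \<open>The Banach algebra of bounded operators\<close>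

text \<open>Complex linearity is a closed condition that is stable under products, so these operators form a
  closed subalgebra of the bounded real-linear ones, from which all structure is inherited.\<close>
typedef 'i op = "{A :: 'i ell2 \<Rightarrow>\<^sub>L 'i ell2. \<forall>c u. A (c *\<^sub>C u) = c *\<^sub>C A u}"
  morphisms blinfun_of_op Abs_op
  by (rule exI[of _ id_blinfun]) simp

setup_lifting type_definition_op

instantiation op :: (type) real_vector
begin
lift_definition zero_op :: "'a op" is 0 by simp
lift_definition plus_op :: "'a op \<Rightarrow> 'a op \<Rightarrow> 'a op" is "(+)"
  by (simp add: blinfun.add_left scaleC_add_right)
lift_definition minus_op :: "'a op \<Rightarrow> 'a op \<Rightarrow> 'a op" is "(-)"
  by (simp add: blinfun.diff_left scaleC_diff_right)
lift_definition uminus_op :: "'a op \<Rightarrow> 'a op" is "uminus"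
  by (simp add: blinfun.minus_left scaleC_minus_right)
lift_definition scaleR_op :: "real \<Rightarrow> 'a op \<Rightarrow> 'a op" is "scaleR"
  by (simp add: blinfun.scaleR_left scaleC_scaleR)
instance
  by standard (transfer; simp add: algebra_simps)+
end

instantiation op :: (type) real_normed_vector
begin
lift_definition norm_op :: "'a op \<Rightarrow> real" is norm .
definition dist_op :: "'a op \<Rightarrow> 'a op \<Rightarrow> real" where "dist_op A B = norm (A - B)"
definition sgn_op :: "'a op \<Rightarrow> 'a op" where "sgn_op A = A /\<^sub>R norm A"
definition uniformity_op :: "('a op \<times> 'a op) filter" where
  "uniformity_op = (INF e\<in>{0<..}. principal {(A, B). dist A B < e})"
definition open_op :: "'a op set \<Rightarrow> bool" where
  "open_op U \<longleftrightarrow> (\<forall>A\<in>U. \<forall>\<^sub>F (A', B) in uniformity. A' = A \<longrightarrow> B \<in> U)"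
instance
proof
  show "norm (A + B) \<le> norm A + norm B" for A B :: "'a op"
    by transfer (rule norm_triangle_ineq)
  show "norm A = 0 \<longleftrightarrow> A = 0" for A :: "'a op" by transfer simp
  show "norm (r *\<^sub>R A) = \<bar>r\<bar> * norm A" for A :: "'a op" and r by transfer simp
qed (simp_all add: dist_op_def sgn_op_def uniformity_op_def open_op_def)
end

instance op :: (type) banach
proof
  fix X :: "nat \<Rightarrow> 'a op"
  assume "Cauchy X"
  then have "Cauchy (\<lambda>k. blinfun_of_op (X k))"
    by (simp add: Cauchy_iff norm_op.rep_eq minus_op.rep_eq)
  then obtain L where L: "(\<lambda>k. blinfun_of_op (X k)) \<longlonglongrightarrow> L"
    by (auto simp: Cauchy_convergent_iff convergent_def)
  have lim: "(\<lambda>k. blinfun_of_op (X k) u) \<longlonglongrightarrow> L u" for u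
    by (intro tendsto_intros L)
  have "L (c *\<^sub>C u) = c *\<^sub>C L u" for c u
  proof (rule LIMSEQ_unique[OF lim])
    show "(\<lambda>k. blinfun_of_op (X k) (c *\<^sub>C u)) \<longlonglongrightarrow> c *\<^sub>C L u"
      using bounded_linear.tendsto[OF bounded_linear_scaleC lim, of c u]
      by (simp add: blinfun_of_op[simplified])
  qed
  then have "blinfun_of_op (Abs_op L) = L"
    by (simp add: Abs_op_inverse)
  then have "X \<longlonglongrightarrow> Abs_op L"
    using L by (simp add: LIMSEQ_iff norm_op.rep_eq minus_op.rep_eq)
  then show "convergent X" by (auto simp: convergent_def)
qed

instantiation op :: (type) real_normed_algebra_1
begin
lift_definition one_op :: "'a op" is id_blinfun by simp
lift_definition times_op :: "'a op \<Rightarrow> 'a op \<Rightarrow> 'a op" is "(o\<^sub>L)" by simp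
instance
proof
  show "(0 :: 'a op) \<noteq> 1"
  proof
    assume "(0 :: 'a op) = 1"
    then have "(0 :: 'a ell2 \<Rightarrow>\<^sub>L 'a ell2) = id_blinfun" by transfer
    then have "blinfun_apply id_blinfun (delta undefined) = (0 :: 'a ell2)"
      by (metis blinfun.zero_left)
    then have "delta undefined = (0 :: 'a ell2)" by simp
    then have "norm (delta undefined :: 'a ell2) = 0" by simp
    then show False by (simp only: norm_delta)
  qed
  show "norm (1 :: 'a op) = 1"
  proof transfer
    have "norm (id_blinfun :: 'a ell2 \<Rightarrow>\<^sub>L 'a ell2) \<ge> norm (delta undefined :: 'a ell2)"
      using norm_blinfun[of id_blinfun "delta undefined :: 'a ell2"] by simp
    moreover have "norm (id_blinfun :: 'a ell2 \<Rightarrow>\<^sub>L 'a ell2) \<le> 1"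
      by (rule norm_blinfun_id_le)
    ultimately show "norm (id_blinfun :: 'a ell2 \<Rightarrow>\<^sub>L 'a ell2) = 1" by simp
  qed
  show "norm (A * B) \<le> norm A * norm B" for A B :: "'a op"
    by transfer (rule norm_blinfun_compose)
qed (transfer; auto intro!: blinfun_eqI simp: blinfun.bilinear_simps)+
end

definition app :: "'i op \<Rightarrow> 'i ell2 \<Rightarrow> 'i ell2"  (infixr "\<cdot>" 74)
  where "app A = blinfun_apply (blinfun_of_op A)"

text \<open>The way back from functions; it is meaningful for bounded complex-linear ones.\<close>
definition op_of :: "('i ell2 \<Rightarrow> 'i ell2) \<Rightarrow> 'i op"
  where "op_of f = Abs_op (Blinfun f)"

lemma app_op_of: "bounded_clinear f \<Longrightarrow> app (op_of f) = f"
  by (simp add: op_of_def app_def bounded_clinear_def Abs_op_inverse bounded_linear_Blinfun_apply)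

lemma op_eqI: "(\<And>u. A \<cdot> u = B \<cdot> u) \<Longrightarrow> A = B"
  by (metis app_def blinfun_eqI blinfun_of_op_inject)

lemma bounded_clinear_app [simp]: "bounded_clinear (app A)"
  using blinfun_of_op[of A] by (auto simp: bounded_clinear_def app_def blinfun.bounded_linear_right)

lemma app_simps [simp]:
  "0 \<cdot> u = 0" "1 \<cdot> u = u" "(A * B) \<cdot> u = A \<cdot> B \<cdot> u"
  "(A + B) \<cdot> u = A \<cdot> u + B \<cdot> u" "(A - B) \<cdot> u = A \<cdot> u - B \<cdot> u" "(- A) \<cdot> u = - (A \<cdot> u)"
  "(r *\<^sub>R A) \<cdot> u = r *\<^sub>R (A \<cdot> u)"
  "A \<cdot> 0 = 0" "A \<cdot> (u + v) = A \<cdot> u + A \<cdot> v" "A \<cdot> (u - v) = A \<cdot> u - A \<cdot> v"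
  "A \<cdot> (r *\<^sub>R u) = r *\<^sub>R (A \<cdot> u)"
  by (simp_all add: app_def zero_op.rep_eq one_op.rep_eq times_op.rep_eq plus_op.rep_eq
      minus_op.rep_eq uminus_op.rep_eq scaleR_op.rep_eq blinfun.bilinear_simps)

lemma app_scaleC: "A \<cdot> (c *\<^sub>C u) = c *\<^sub>C (A \<cdot> u)"
  using bounded_clinear_app[of A] by (simp add: bounded_clinear_def)

lemma norm_app_le: "norm (A \<cdot> u) \<le> norm A * norm u"
  unfolding app_def norm_op.rep_eq by (rule norm_blinfun)

lemma norm_op_le: "(\<And>u. norm (A \<cdot> u) \<le> b * norm u) \<Longrightarrow> 0 \<le> b \<Longrightarrow> norm A \<le> b"
  unfolding app_def norm_op.rep_eq by (rule norm_blinfun_bound)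

lemma bounded_linear_app_left: "bounded_linear (\<lambda>A. A \<cdot> u)"
  by (rule bounded_linear_intro[where K = "norm u"])
     (auto intro: norm_app_le)

section \<open>The binomial series of the square root\<close>

text \<open>The Taylor coefficients of \<open>(1 - x)\<^sup>1\<^sup>/\<^sup>2\<close> at \<open>0\<close>.\<close>
definition rt_coeff :: "nat \<Rightarrow> real"
  where "rt_coeff j = (1/2 gchoose j) * (- 1) ^ j"

lemma gbinomial_Suc_ratio: "(a gchoose Suc k) = (a gchoose k) * (a - of_nat k) / (of_nat k + 1)" for a :: real
  using gbinomial_mult_1[of a k] by (simp add: field_simps)

lemma rt_coeff_0 [simp]: "rt_coeff 0 = 1"
  by (simp add: rt_coeff_def)

lemma rt_coeff_nonpos:
  assumes "j > 0"
  shows "rt_coeff j \<le> 0"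
proof -
  have "rt_coeff (Suc j) \<le> 0" for j
  proof (induction j)
    case (Suc j)
    have "rt_coeff (Suc (Suc j)) = rt_coeff (Suc j) * ((real j + 1/2) / (real j + 2))"
      unfolding rt_coeff_def gbinomial_Suc_ratio[of _ "Suc j"] by (simp add: field_simps)
    then show ?case using Suc by (metis mult_nonpos_nonneg divide_nonneg_nonneg add_nonneg_nonneg of_nat_0_le_iff zero_le_numeral zero_le_divide_1_iff)
  qed (simp add: rt_coeff_def)
  then show ?thesis using assms by (metis gr0_conv_Suc)
qed

text \<open>The partial sums telescope to \<open>(- 1)\<^sup>m (- 1/2 gchoose m)\<close>, a product of positive factors. As only
  the coefficient of index \<open>0\<close> is positive, the lower bound \<open>0\<close> already forces absolute summability.\<close>
lemma sum_rt_coeff_nonneg: "0 \<le> (\<Sum>j<n. rt_coeff j)"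
proof (cases n)
  case (Suc m)
  have "0 \<le> (- 1) ^ m * (- 1/2 gchoose m :: real)"
  proof (induction m)
    case (Suc m)
    have "(- 1) ^ Suc m * (- 1/2 gchoose Suc m :: real)
        = (- 1) ^ m * (- 1/2 gchoose m) * ((real m + 1/2) / (real m + 1))"
      unfolding gbinomial_Suc_ratio by (simp add: field_simps)
    then show ?case using Suc by simp
  qed simp
  then show ?thesis
    using gbinomial_sum_lower_neg[of "1/2 :: real" m] by (simp add: Suc lessThan_Suc_atMost rt_coeff_def)
qed simp

lemma summable_rt_coeff: "summable (\<lambda>j. \<bar>rt_coeff j\<bar>)"
proof (rule summableI_nonneg_bounded)
  fix n
  have "\<bar>rt_coeff j\<bar> = (if j = 0 then 2 else 0) - rt_coeff j" for j
    using rt_coeff_nonpos[of j] by auto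
  then have "(\<Sum>j<n. \<bar>rt_coeff j\<bar>) = (\<Sum>j<n. if j = 0 then 2 else 0) - (\<Sum>j<n. rt_coeff j)"
    by (simp add: sum_subtractf)
  also have "\<dots> \<le> 2"
    using sum_rt_coeff_nonneg[of n] by simp
  finally show "(\<Sum>j<n. \<bar>rt_coeff j\<bar>) \<le> 2" .
qed simp

definition sqrt_1m :: "'a \<Rightarrow> 'a :: {real_normed_algebra_1, banach}"
  where "sqrt_1m x = (\<Sum>j. rt_coeff j *\<^sub>R x ^ j)"

lemma summable_sqrt_1m:
  fixes x :: "'a :: {real_normed_algebra_1, banach}"
  assumes "norm x \<le> 1"
  shows "summable (\<lambda>j. norm (rt_coeff j *\<^sub>R x ^ j))"
proof (rule summable_comparison_test'[OF summable_rt_coeff])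
  fix j
  have "norm (x ^ j) \<le> 1"
    using norm_power_ineq[of x j] power_le_one[of "norm x" j] assms by simp
  then show "norm (norm (rt_coeff j *\<^sub>R x ^ j)) \<le> \<bar>rt_coeff j\<bar>"
    by (simp add: mult_left_le)
qed

lemma sqrt_1m_sums:
  fixes x :: "'a :: {real_normed_algebra_1, banach}"
  assumes "norm x \<le> 1"
  shows "(\<lambda>j. rt_coeff j *\<^sub>R x ^ j) sums sqrt_1m x"
  unfolding sqrt_1m_def using summable_norm_cancel[OF summable_sqrt_1m[OF assms]] by (rule summable_sums)

text \<open>The Cauchy product of the series with itself has the coefficients
  \<open>(- 1)\<^sup>k (1 gchoose k)\<close>, by Vandermonde's identity.\<close>
lemma sqrt_1m_square:
  fixes x :: "'a :: {real_normed_algebra_1, banach}"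
  assumes "norm x \<le> 1"
  shows "sqrt_1m x * sqrt_1m x = 1 - x"
proof (rule sums_unique2)
  have conv: "(\<Sum>i\<le>k. (rt_coeff i *\<^sub>R x ^ i) * (rt_coeff (k - i) *\<^sub>R x ^ (k - i)))
      = (if k = 0 then 1 else if k = 1 then - x else 0)" for k
  proof -
    have "(\<Sum>i\<le>k. (rt_coeff i *\<^sub>R x ^ i) * (rt_coeff (k - i) *\<^sub>R x ^ (k - i)))
        = (\<Sum>i\<le>k. (((1/2 gchoose i) * (1/2 gchoose (k - i))) * (- 1) ^ k) *\<^sub>R x ^ k)"
    proof (rule sum.cong)
      fix i assume "i \<in> {..k}"
      then have "x ^ i * x ^ (k - i) = x ^ k" "(- 1 :: real) ^ i * (- 1) ^ (k - i) = (- 1) ^ k"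
        by (simp_all flip: power_add)
      then show "(rt_coeff i *\<^sub>R x ^ i) * (rt_coeff (k - i) *\<^sub>R x ^ (k - i))
          = (((1/2 gchoose i) * (1/2 gchoose (k - i))) * (- 1) ^ k) *\<^sub>R x ^ k"
        by (simp add: rt_coeff_def mult_ac)
    qed simp
    also have "\<dots> = ((\<Sum>i\<le>k. (1/2 gchoose i) * (1/2 gchoose (k - i))) * (- 1) ^ k) *\<^sub>R x ^ k"
      by (simp add: scaleR_sum_left sum_distrib_right)
    also have "(\<Sum>i\<le>k. (1/2 gchoose i) * (1/2 gchoose (k - i)) :: real) = (1 gchoose k)"
      using gbinomial_Vandermonde[of "1/2 :: real" "1/2" k] by (simp add: atLeast0AtMost)
    also have "(1 gchoose k :: real) = of_nat (1 choose k)"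
      using binomial_gbinomial[of 1 k, where ?'a = real] by simp
    also have "(of_nat (1 choose k) * (- 1) ^ k) *\<^sub>R x ^ k = (if k = 0 then 1 else if k = 1 then - x else 0)"
      by (auto simp: binomial_eq_0)
    finally show ?thesis .
  qed
  show "(\<lambda>k. \<Sum>i\<le>k. (rt_coeff i *\<^sub>R x ^ i) * (rt_coeff (k - i) *\<^sub>R x ^ (k - i)))
          sums (sqrt_1m x * sqrt_1m x)"
    unfolding sqrt_1m_def
    by (rule Cauchy_product_sums; rule summable_sqrt_1m[OF assms])
  have "(\<lambda>k. if k = 0 then 1 else if k = 1 then - x else 0) sums (\<Sum>k\<in>{0,1::nat}. if k = 0 then 1 else if k = 1 then - x else 0)"
    by (rule sums_finite) auto
  then show "(\<lambda>k. \<Sum>i\<le>k. (rt_coeff i *\<^sub>R x ^ i) * (rt_coeff (k - i) *\<^sub>R x ^ (k - i))) sums (1 - x)"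
    unfolding conv by simp
qed

text \<open>All coefficients but the first are nonpositive, so the partial sums at \<open>t\<close> dominate those
  at \<open>1\<close>.\<close>
lemma sqrt_1m_nonneg:
  fixes t :: real
  assumes "0 \<le> t" "t \<le> 1"
  shows "0 \<le> sqrt_1m t"
proof -
  have "(\<Sum>j<n. rt_coeff j) \<le> (\<Sum>j<n. rt_coeff j *\<^sub>R t ^ j)" for n
  proof (rule sum_mono)
    fix j show "rt_coeff j \<le> rt_coeff j *\<^sub>R t ^ j"
      using rt_coeff_nonpos[of j] power_le_one[OF assms, of j]
      by (cases "j = 0") (auto simp: mult_left_le mult_le_cancel_left1)
  qed
  then have "0 \<le> (\<Sum>j<n. rt_coeff j *\<^sub>R t ^ j)" for n
    using sum_rt_coeff_nonneg order_trans by blast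
  then show ?thesis
    using sqrt_1m_sums[of t] assms unfolding sums_def by (intro LIMSEQ_le_const) auto
qed

lemma sqrt_1m_real:
  fixes t :: real
  assumes "0 \<le> t" "t \<le> 1"
  shows "sqrt_1m t = sqrt (1 - t)"
  using sqrt_1m_square[of t] sqrt_1m_nonneg[OF assms] assms
  by (intro real_sqrt_unique[symmetric]) (auto simp: power2_eq_square)

lemma rt_coeff_sums_0: "rt_coeff sums 0"
  using sqrt_1m_sums[of "1 :: real"] sqrt_1m_real[of 1] by simp

text \<open>Because the coefficients sum to \<open>0\<close>, the square root is also a series in the polynomials
  \<open>1 - t\<^sup>j\<close>. They vanish at \<open>t = 1\<close> and all terms are nonnegative; this form is what makes the
  comparison with moments of order at least \<open>1\<close> possible.\<close>
lemma sums_rt_coeff_gap: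
  fixes t :: real
  assumes "0 \<le> t" "t \<le> 1"
  shows "(\<lambda>j. - rt_coeff j * (1 - t ^ j)) sums sqrt (1 - t)"
  using sums_diff[OF sqrt_1m_sums[of t] rt_coeff_sums_0] assms
  by (simp add: sqrt_1m_real algebra_simps)

section \<open>Positive operators and their square roots\<close>

text \<open>For complex-linear operators, symmetry for the real inner product amounts to self-adjointness.\<close>
definition symmetric :: "'i op \<Rightarrow> bool"
  where "symmetric A \<longleftrightarrow> (\<forall>u v. inner (A \<cdot> u) v = inner u (A \<cdot> v))"

definition pos :: "'i op \<Rightarrow> bool"
  where "pos A \<longleftrightarrow> symmetric A \<and> (\<forall>u. 0 \<le> inner u (A \<cdot> u))"

lemma symmetricD: "symmetric A \<Longrightarrow> inner (A \<cdot> u) v = inner u (A \<cdot> v)"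
  by (simp add: symmetric_def)

lemma posD: "pos A \<Longrightarrow> 0 \<le> inner u (A \<cdot> u)"
  by (simp add: pos_def)

lemma pos_symmetric: "pos A \<Longrightarrow> symmetric A"
  by (simp add: pos_def)

lemma symmetric_cinner:
  assumes "symmetric A"
  shows "cinner (A \<cdot> u) v = cinner u (A \<cdot> v)"
  using symmetricD[OF assms, of "\<i> *\<^sub>C u" v] symmetricD[OF assms, of u v]
  by (simp add: cinner_eq_inner app_scaleC)

lemma symmetric_algebra:
  "symmetric 1"
  "symmetric A \<Longrightarrow> symmetric B \<Longrightarrow> symmetric (A + B)"
  "symmetric A \<Longrightarrow> symmetric B \<Longrightarrow> symmetric (A - B)"
  "symmetric A \<Longrightarrow> symmetric (r *\<^sub>R A)"
  by (simp_all add: symmetric_def inner_add_left inner_add_right inner_diff_left inner_diff_right)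

lemma symmetric_mult:
  "symmetric A \<Longrightarrow> symmetric B \<Longrightarrow> A * B = B * A \<Longrightarrow> symmetric (A * B)"
  by (metis app_simps(3) symmetric_def)

lemma symmetric_sandwich:
  "symmetric A \<Longrightarrow> symmetric B \<Longrightarrow> symmetric (B * A * B)"
  by (simp add: symmetric_def)

lemma symmetric_power: "symmetric A \<Longrightarrow> symmetric (A ^ j)"
  by (induction j) (auto intro: symmetric_mult symmetric_algebra simp: power_commutes)

lemma pos_square: "symmetric A \<Longrightarrow> pos (A * A)"
  unfolding pos_def by (simp add: symmetric_mult) (metis symmetricD inner_ge_zero)

lemma cadjoint_symmetric:
  assumes "symmetric A"
  shows "cadjoint (app A) = app A"
  unfolding cadjoint_def
proof (rule the_equality)
  show "bounded_clinear (app A) \<and> (\<forall>u v. cinner (A \<cdot> u) v = cinner u (A \<cdot> v))"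
    using symmetric_cinner[OF assms] by simp
next
  fix B assume "bounded_clinear B \<and> (\<forall>u v. cinner (A \<cdot> u) v = cinner u (B v))"
  then have "cinner (delta n) (B v) = cinner (delta n) (A \<cdot> v)" for n v
    using symmetric_cinner[OF assms] by metis
  then have "coord (B v) = coord (A \<cdot> v)" for v
    by (simp add: cinner_delta_left fun_eq_iff)
  then show "B = app A"
    unfolding coord_inject by (rule ext)
qed

text \<open>If \<open>\<langle>u, A u\<rangle>\<close> is real for all \<open>u\<close>, polarization shows that
  \<open>(u, v) \<mapsto> Re \<langle>\<i> u, A v\<rangle>\<close> is antisymmetric; substituting \<open>\<i> u\<close> for \<open>u\<close> yields the symmetry of \<open>A\<close>.\<close>
lemma positive_op_app: "positive_op (app A) \<longleftrightarrow> pos A"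
proof
  assume pos: "positive_op (app A)"
  have ge0: "0 \<le> inner u (A \<cdot> u)" and Im0: "inner (\<i> *\<^sub>C u) (A \<cdot> u) = 0" for u
    using pos unfolding positive_op_def cinner_eq_inner
    by (auto simp: complex_nonneg_Reals_iff)
  have anti: "inner (\<i> *\<^sub>C u) (A \<cdot> v) = - inner (\<i> *\<^sub>C v) (A \<cdot> u)" for u v
    using Im0[of "u + v"] Im0[of u] Im0[of v]
    by (simp add: scaleC_add_right inner_add_left inner_add_right)
  have "inner (A \<cdot> u) v = inner u (A \<cdot> v)" for u v
    using anti[of "\<i> *\<^sub>C u" v] inner_scaleC_i[of "\<i> *\<^sub>C u" "A \<cdot> v"] inner_scaleC_i[of v "\<i> *\<^sub>C (A \<cdot> u)"]
      inner_scaleC_i[of u "\<i> *\<^sub>C (A \<cdot> v)"] scaleC_of_real[of "-1" u]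
      scaleC_of_real[of "-1" "A \<cdot> u"] scaleC_of_real[of "-1" "A \<cdot> v"]
    by (simp add: app_scaleC scaleC_scaleC inner_commute)
  then show "pos A" using ge0 by (simp add: pos_def symmetric_def)
next
  assume pos: "pos A"
  have "inner (\<i> *\<^sub>C u) (A \<cdot> u) = 0" for u
    using symmetricD[OF pos_symmetric[OF pos], of "\<i> *\<^sub>C u" u] inner_scaleC_i[of "A \<cdot> u" u]
    by (simp add: app_scaleC inner_commute)
  then show "positive_op (app A)"
    using posD[OF pos] by (simp add: positive_op_def cinner_eq_inner complex_nonneg_Reals_iff)
qed

lemma pos_Cauchy_Schwarz:
  assumes "pos A"
  shows "(inner u (A \<cdot> v))\<^sup>2 \<le> inner u (A \<cdot> u) * inner v (A \<cdot> v)"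
proof -
  define p q r where "p = inner u (A \<cdot> u)" and "q = inner u (A \<cdot> v)" and "r = inner v (A \<cdot> v)"
  have sym: "inner v (A \<cdot> u) = q"
    using symmetricD[OF pos_symmetric[OF assms], of u v] by (simp add: q_def inner_commute)
  have quad: "0 \<le> s\<^sup>2 * p + 2 * s * t * q + t\<^sup>2 * r" for s t
    using posD[OF assms, of "s *\<^sub>R u + t *\<^sub>R v"] sym
    by (simp add: inner_add_left inner_add_right p_def q_def r_def power2_eq_square algebra_simps)
  have "q\<^sup>2 \<le> p * r"
  proof (cases "r = 0")
    case True
    have "p \<ge> 0" unfolding p_def by (rule posD[OF assms])
    have "0 \<le> p + 2 * t * q" for t
      using quad[of 1 t] True by simp
    \<comment> \<open>This choice makes the affine function of \<open>t\<close> negative when \<open>q \<noteq> 0\<close>.\<close>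
    from this[of "- (p + 1) / q"] have "q = 0"
      using \<open>p \<ge> 0\<close> by (cases "q = 0") auto
    then show ?thesis using True by simp
  next
    case False
    then have "r > 0" using posD[OF assms, of v] by (simp add: r_def)
    \<comment> \<open>The form is evaluated at \<open>r u - q v\<close>, the multiple by \<open>r\<close> of the part of \<open>u\<close> orthogonal to \<open>v\<close>.\<close>
    have "0 \<le> r * (p * r - q\<^sup>2)"
      using quad[of r "- q"] by (simp add: power2_eq_square algebra_simps)
    then show ?thesis using \<open>r > 0\<close> by (simp add: zero_le_mult_iff)
  qed
  then show ?thesis by (simp add: p_def q_def r_def)
qed

text \<open>The Cauchy--Schwarz inequality for the form of \<open>A\<close>, applied to \<open>A u\<close> and \<open>u\<close>, bounds
  \<open>\<parallel>A u\<parallel>\<^sup>4\<close> by \<open>b\<^sup>2 \<parallel>A u\<parallel>\<^sup>2 \<parallel>u\<parallel>\<^sup>2\<close>.\<close>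
lemma pos_norm_le:
  assumes "pos A" and b: "\<And>u. inner u (A \<cdot> u) \<le> b * (norm u)\<^sup>2" "b \<ge> 0"
  shows "norm A \<le> b"
proof (rule norm_op_le)
  fix u
  let ?n = "norm (A \<cdot> u)"
  have "(?n\<^sup>2)\<^sup>2 = (inner (A \<cdot> u) (A \<cdot> u))\<^sup>2"
    by (simp add: power2_norm_eq_inner)
  also have "\<dots> \<le> inner (A \<cdot> u) (A \<cdot> A \<cdot> u) * inner u (A \<cdot> u)"
    by (rule pos_Cauchy_Schwarz[OF assms(1)])
  also have "\<dots> \<le> (b * ?n\<^sup>2) * (b * (norm u)\<^sup>2)"
    by (intro mult_mono b posD[OF assms(1)]) (simp add: b)
  finally have "?n\<^sup>2 * ?n\<^sup>2 \<le> ?n\<^sup>2 * (b * norm u)\<^sup>2"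
    by (simp only: power2_eq_square mult_ac)
  then have "?n = 0 \<or> ?n\<^sup>2 \<le> (b * norm u)\<^sup>2"
    by (meson mult_le_cancel_left_pos zero_less_power2)
  then show "?n \<le> b * norm u"
    using b(2) by (auto simp: power2_le_iff_abs_le)
qed (rule b)

lemma inner_app_le: "inner u (A \<cdot> v) \<le> norm A * (norm u * norm v)"
  using norm_cauchy_schwarz[of u "A \<cdot> v"] mult_left_mono[OF norm_app_le[of A v] norm_ge_zero[of u]]
  by (simp add: mult_ac)

lemma inner_sums_op:
  assumes "X sums A"
  shows "(\<lambda>j. inner u (X j \<cdot> v)) sums inner u (A \<cdot> v)"
  by (intro bounded_linear.sums[OF bounded_linear_inner_right]
      bounded_linear.sums[OF bounded_linear_app_left] assms)

lemma symmetric_sums: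
  assumes "X sums A" "\<And>j. symmetric (X j)"
  shows "symmetric A"
  unfolding symmetric_def
proof (intro allI)
  fix u v
  have "(\<lambda>j. inner u (X j \<cdot> v)) sums inner v (A \<cdot> u)"
    using inner_sums_op[OF assms(1), of v u] symmetricD[OF assms(2), of _ u v] by (simp add: inner_commute)
  from sums_unique2[OF this inner_sums_op[OF assms(1)]] show "inner (A \<cdot> u) v = inner u (A \<cdot> v)"
    by (simp add: inner_commute)
qed

lemma commute_sums:
  fixes C :: "'a :: real_normed_algebra"
  assumes "X sums A" "\<And>j. C * X j = X j * C"
  shows "C * A = A * C"
  using bounded_linear.sums[OF bounded_linear_mult_right assms(1), of C]
    bounded_linear.sums[OF bounded_linear_mult_left assms(1), of C] assms(2)
  by (simp add: sums_unique2)

text \<open>For \<open>j \<ge> 1\<close> the coefficient is nonpositive and \<open>\<langle>u, X\<^sup>j u\<rangle> \<le> \<parallel>u\<parallel>\<^sup>2\<close>, so the quadratic form of the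
  series is bounded below by \<open>\<parallel>u\<parallel>\<^sup>2\<close> times the sum of the coefficients, which is \<open>0\<close>.\<close>
lemma pos_sqrt_1m:
  fixes X :: "'i op"
  assumes "symmetric X" "norm X \<le> 1"
  shows "pos (sqrt_1m X)"
  unfolding pos_def
proof (intro conjI allI)
  note Q = sqrt_1m_sums[OF assms(2)]
  show "symmetric (sqrt_1m X)"
    by (rule symmetric_sums[OF Q]) (intro symmetric_algebra symmetric_power assms)
  fix u :: "'i ell2"
  have "(\<lambda>j. rt_coeff j * (norm u)\<^sup>2) sums (0 * (norm u)\<^sup>2)"
    by (rule sums_mult2) (rule rt_coeff_sums_0)
  then have 0: "(\<lambda>j. rt_coeff j * (norm u)\<^sup>2) sums 0" by simp
  show "0 \<le> inner u (sqrt_1m X \<cdot> u)"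
  proof (rule sums_le[OF _ 0 inner_sums_op[OF Q]])
    fix j
    have "norm (X ^ j) \<le> 1"
      using norm_power_ineq[of X j] power_le_one[of "norm X" j] assms by simp
    then have "inner u (X ^ j \<cdot> u) \<le> (norm u)\<^sup>2"
      using inner_app_le[of u "X ^ j" u] mult_right_mono[of "norm (X ^ j)" 1 "norm u * norm u"]
      by (simp add: power2_eq_square)
    then show "rt_coeff j * (norm u)\<^sup>2 \<le> inner u (rt_coeff j *\<^sub>R X ^ j \<cdot> u)"
      using rt_coeff_nonpos[of j]
      by (cases "j = 0") (auto simp: power2_norm_eq_inner intro: mult_left_mono_neg)
  qed
qed

text \<open>Scaling a positive operator by \<open>c = norm A + 1\<close> puts \<open>1 - A / c\<close> into the unit ball; the summand
  \<open>1\<close> only keeps \<open>c\<close> away from \<open>0\<close>.\<close>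
definition op_sqrt :: "'i op \<Rightarrow> 'i op"
  where "op_sqrt A = sqrt (norm A + 1) *\<^sub>R sqrt_1m (1 - A /\<^sub>R (norm A + 1))"

lemma pos_complement:
  assumes "pos A" "norm A \<le> c" "c > 0"
  shows "pos (1 - A /\<^sub>R c)"
  unfolding pos_def
proof (intro conjI allI)
  fix u
  have "inner u (A \<cdot> u) \<le> c * (norm u)\<^sup>2"
    using inner_app_le[of u A u] mult_right_mono[OF assms(2), of "norm u * norm u"]
    by (simp add: power2_eq_square)
  then show "0 \<le> inner u ((1 - A /\<^sub>R c) \<cdot> u)"
    using assms(3) by (simp add: inner_diff_right field_simps power2_norm_eq_inner)
qed (intro symmetric_algebra pos_symmetric assms(1))

lemma norm_complement_le_1:
  assumes "pos A" "norm A \<le> c" "c > 0"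
  shows "norm (1 - A /\<^sub>R c) \<le> 1"
proof (rule pos_norm_le[OF pos_complement[OF assms]])
  fix u
  show "inner u ((1 - A /\<^sub>R c) \<cdot> u) \<le> 1 * (norm u)\<^sup>2"
    using posD[OF assms(1), of u] assms(3) by (simp add: inner_diff_right power2_norm_eq_inner)
qed simp

context
  fixes A :: "'i op"
  assumes A: "pos A"
begin

lemma norm_sqrt_arg: "norm (1 - A /\<^sub>R (norm A + 1)) \<le> 1"
  by (rule norm_complement_le_1[OF A]) (simp_all add: add_nonneg_pos)

lemma pos_op_sqrt: "pos (op_sqrt A)"
proof -
  have "pos (sqrt_1m (1 - A /\<^sub>R (norm A + 1)))"
    by (intro pos_sqrt_1m norm_sqrt_arg symmetric_algebra pos_symmetric A)
  then show ?thesis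
    by (simp add: pos_def op_sqrt_def symmetric_algebra)
qed

lemma op_sqrt_square: "op_sqrt A * op_sqrt A = A"
proof -
  have "norm A + 1 > 0" by (simp add: add_nonneg_pos)
  then show ?thesis
    by (simp add: op_sqrt_def sqrt_1m_square[OF norm_sqrt_arg] flip: mult.assoc)
qed

lemma op_sqrt_commute:
  assumes "C * A = A * C"
  shows "C * op_sqrt A = op_sqrt A * C"
proof -
  have "C * (1 - A /\<^sub>R (norm A + 1)) = (1 - A /\<^sub>R (norm A + 1)) * C"
    using assms by (simp add: algebra_simps)
  then have "C * (1 - A /\<^sub>R (norm A + 1)) ^ j = (1 - A /\<^sub>R (norm A + 1)) ^ j * C" for j
    by (metis power_commuting_commutes)
  then have "C * sqrt_1m (1 - A /\<^sub>R (norm A + 1)) = sqrt_1m (1 - A /\<^sub>R (norm A + 1)) * C"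
    by (intro commute_sums[OF sqrt_1m_sums[OF norm_sqrt_arg]]) simp
  then show ?thesis by (simp add: op_sqrt_def)
qed

lemma norm_app_op_sqrt: "(norm (op_sqrt A \<cdot> u))\<^sup>2 = inner u (A \<cdot> u)"
  using symmetricD[OF pos_symmetric[OF pos_op_sqrt], of u "op_sqrt A \<cdot> u"]
  by (simp add: power2_norm_eq_inner op_sqrt_square flip: app_simps(3))

text \<open>Let \<open>B\<close> be the square root given by the series. It commutes with whatever commutes with \<open>A\<close>, in
  particular with \<open>C\<close>, whence \<open>(B + C) (B - C) = B\<^sup>2 - C\<^sup>2 = 0\<close>. So both positive forms vanish at
  \<open>y = (B - C) u\<close>, which gives \<open>B y = C y = 0\<close> and then \<open>\<parallel>y\<parallel>\<^sup>2 = \<langle>u, (B - C) y\<rangle> = 0\<close>.\<close>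
lemma pos_sqrt_unique:
  assumes C: "pos C" "C * C = A"
  shows "C = op_sqrt A"
proof (rule op_eqI)
  fix u
  let ?B = "op_sqrt A"
  have "C * A = A * C" using C(2) by (simp add: mult.assoc flip: C(2))
  then have comm: "C * ?B = ?B * C" by (rule op_sqrt_commute)
  define y where "y = (?B - C) \<cdot> u"
  have "(?B + C) * (?B - C) = 0"
    using comm C(2) op_sqrt_square by (simp add: algebra_simps)
  then have sum0: "(?B + C) \<cdot> y = 0"
    unfolding y_def by (metis app_simps(1,3))
  then have "inner y (?B \<cdot> y) + inner y (C \<cdot> y) = 0"
    by (metis app_simps(4) inner_add_right inner_zero_right)
  then have "inner y (?B \<cdot> y) = 0" and "inner y (C \<cdot> y) = 0"
    using posD[OF C(1), of y] posD[OF pos_op_sqrt, of y] by linarith+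
  then have "(inner v (?B \<cdot> y))\<^sup>2 \<le> 0" "(inner v (C \<cdot> y))\<^sup>2 \<le> 0" for v
    using pos_Cauchy_Schwarz[OF pos_op_sqrt, of v y] pos_Cauchy_Schwarz[OF C(1), of v y] by simp_all
  then have "?B \<cdot> y = 0" "C \<cdot> y = 0"
    by (metis inner_eq_zero_iff power2_less_eq_zero_iff)+
  then have "inner u ((?B - C) \<cdot> y) = 0" by simp
  then have "inner y y = 0"
    using symmetricD[OF symmetric_algebra(3)[OF pos_symmetric[OF pos_op_sqrt] pos_symmetric[OF C(1)]], of u y]
    by (simp add: y_def)
  then show "C \<cdot> u = ?B \<cdot> u" by (simp add: y_def)
qed

lemma sqrt_op_app: "sqrt_op (app A) = app (op_sqrt A)"
  unfolding sqrt_op_def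
proof (rule the_equality)
  show "positive_op (app (op_sqrt A)) \<and> app (op_sqrt A) \<circ> app (op_sqrt A) = app A"
    by (simp add: positive_op_app pos_op_sqrt fun_eq_iff op_sqrt_square flip: app_simps(3))
next
  fix B assume B: "positive_op B \<and> B \<circ> B = app A"
  then have B': "app (op_of B) = B" by (simp add: app_op_of positive_op_def)
  then have "pos (op_of B)" using B by (metis positive_op_app)
  moreover have "op_of B * op_of B = A"
    using B B' by (intro op_eqI) (simp add: fun_eq_iff)
  ultimately show "B = app (op_sqrt A)" using pos_sqrt_unique B' by metis
qed

end

section \<open>The modulus of a symmetric operator\<close>

definition op_abs :: "'i op \<Rightarrow> 'i op"
  where "op_abs A = op_sqrt (A * A)"

lemma abs_op_app:
  assumes "symmetric A"
  shows "abs_op (app A) = app (op_abs A)"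
proof -
  have "app A \<circ> app A = app (A * A)" by (simp add: fun_eq_iff)
  then show ?thesis
    by (simp add: abs_op_def cadjoint_symmetric[OF assms] op_abs_def sqrt_op_app[OF pos_square[OF assms]])
qed

lemma neumann_series:
  fixes y :: "'a :: {real_normed_algebra_1, banach}"
  assumes "norm y < 1"
  obtains g where "(\<lambda>k. y ^ k) sums g" "(1 - y) * g = 1" "g * (1 - y) = 1"
proof -
  obtain g where g: "(\<lambda>k. y ^ k) sums g"
    using complete_algebra_summable_geometric[OF assms] by (auto simp: summable_def)
  have "(\<lambda>k. y ^ k) \<longlonglongrightarrow> 0"
    using complete_algebra_summable_geometric[OF assms] by (rule summable_LIMSEQ_zero)
  from telescope_sums'[OF this] have "(\<lambda>k. y ^ k - y ^ Suc k) sums 1" by simp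
  then have tele: "(\<lambda>k. (1 - y) * y ^ k) sums 1" by (simp add: algebra_simps)
  have "(1 - y) * g = 1"
    using bounded_linear.sums[OF bounded_linear_mult_right g, of "1 - y"] tele by (rule sums_unique2)
  moreover have "(1 - y) * g = g * (1 - y)"
    by (rule commute_sums[OF g]) (simp add: algebra_simps power_commutes)
  ultimately show thesis using that[OF g] by simp
qed

text \<open>A multiple of \<open>M + e\<close> differs from \<open>1\<close> by an operator \<open>Y\<close> with \<open>0 \<le> Y \<le> 1 - e / c < 1\<close>, so the
  Neumann series applies.\<close>
lemma pos_shift_inverse:
  fixes M :: "'i op"
  assumes "pos M" "e > 0"
  obtains G where "(M + e *\<^sub>R 1) * G = 1" "G * (M + e *\<^sub>R 1) = 1"
proof -
  define c where "c = norm M + e"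
  have c: "c > 0" "norm M \<le> c" "e \<le> c" using assms(2) by (simp_all add: c_def add_nonneg_pos)
  define P where "P = M + e *\<^sub>R 1"
  define Y where "Y = 1 - P /\<^sub>R c"
  have posP: "pos P"
    using assms unfolding pos_def P_def by (simp add: symmetric_algebra inner_add_right)
  have "norm P \<le> c"
    using norm_triangle_ineq[of M "e *\<^sub>R 1"] assms(2) by (simp add: P_def c_def)
  then have posY: "pos Y"
    unfolding Y_def by (intro pos_complement posP c)
  have "norm Y \<le> 1 - e / c"
  proof (rule pos_norm_le[OF posY])
    fix u
    have "e * (norm u)\<^sup>2 \<le> inner u (P \<cdot> u)"
      using posD[OF assms(1), of u] by (simp add: P_def inner_add_right power2_norm_eq_inner)
    then show "inner u (Y \<cdot> u) \<le> (1 - e / c) * (norm u)\<^sup>2"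
      using c(1) by (simp add: Y_def inner_diff_right power2_norm_eq_inner field_simps)
  qed (use c in simp)
  also have "\<dots> < 1" using c(1) assms(2) by simp
  finally obtain g where g: "(1 - Y) * g = 1" "g * (1 - Y) = 1"
    by (rule neumann_series) auto
  have "P = c *\<^sub>R (1 - Y)" using c(1) by (simp add: Y_def)
  then have "P * (g /\<^sub>R c) = 1" "(g /\<^sub>R c) * P = 1" using g c(1) by simp_all
  then show thesis using that unfolding P_def by blast
qed

lemma op_abs_square: "symmetric A \<Longrightarrow> op_abs A * op_abs A = A * A"
  by (simp add: op_abs_def op_sqrt_square pos_square)

lemma pos_op_abs: "symmetric A \<Longrightarrow> pos (op_abs A)"
  by (simp add: op_abs_def pos_op_sqrt pos_square)

lemma norm_app_op_abs:
  assumes "symmetric A"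
  shows "norm (op_abs A \<cdot> u) = norm (A \<cdot> u)"
proof -
  have "inner (op_abs A \<cdot> u) (op_abs A \<cdot> u) = inner (A \<cdot> u) (A \<cdot> u)"
    using symmetricD[OF assms] symmetricD[OF pos_symmetric[OF pos_op_abs[OF assms]]]
      op_abs_square[OF assms] by (metis app_simps(3))
  then show ?thesis by (simp add: norm_eq_sqrt_inner)
qed

text \<open>Positivity of the modulus gives \<open>\<parallel>A v\<parallel> = \<parallel>\<bar>A\<bar> v\<parallel> \<le> \<parallel>(\<bar>A\<bar> + e) v\<parallel>\<close>. The operator \<open>A G\<close> serves as an
  approximate sign of \<open>A\<close>.\<close>
lemma sign_contraction:
  assumes A: "symmetric A" and "e \<ge> 0" and G: "(op_abs A + e *\<^sub>R 1) * G = 1"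
  shows "norm ((A * G) \<cdot> u) \<le> norm u"
proof -
  let ?M = "op_abs A" and ?v = "G \<cdot> u"
  have "(norm (A \<cdot> ?v))\<^sup>2 = (norm (?M \<cdot> ?v))\<^sup>2" by (simp add: norm_app_op_abs[OF A])
  also have "\<dots> \<le> (norm (?M \<cdot> ?v))\<^sup>2 + 2 * e * inner ?v (?M \<cdot> ?v) + e\<^sup>2 * (norm ?v)\<^sup>2"
    using posD[OF pos_op_abs[OF A], of ?v] assms(2) by simp
  also have "\<dots> = (norm (?M \<cdot> ?v + e *\<^sub>R ?v))\<^sup>2"
    unfolding power2_norm_eq_inner
    by (simp add: inner_add_left inner_add_right inner_commute power2_eq_square algebra_simps)
  also have "?M \<cdot> ?v + e *\<^sub>R ?v = ((?M + e *\<^sub>R 1) * G) \<cdot> u" by simp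
  finally show ?thesis using G by (simp add: power2_le_iff_abs_le)
qed

lemma le_of_le_add_epsilon_mult:
  fixes x y c :: real
  assumes "\<And>e. e > 0 \<Longrightarrow> x \<le> y + e * c" "c \<ge> 0"
  shows "x \<le> y"
proof (rule field_le_epsilon)
  fix e :: real assume "e > 0"
  then have "x \<le> y + e / (c + 1) * c" using assms(2) by (intro assms(1)) simp
  also have "e / (c + 1) * c \<le> e" using \<open>e > 0\<close> assms(2) by (simp add: field_simps)
  finally show "x \<le> y + e" by simp
qed

text \<open>With \<open>B = \<bar>R\<bar>\<close>, \<open>K = B\<^sup>1\<^sup>/\<^sup>2\<close> and \<open>G = (B + e)\<^sup>-\<^sup>1\<close>, all of which commute with \<open>K\<close>, one has
  \<open>R = K (R G) K + e R G\<close>, where \<open>R G\<close> is a contraction. Then let \<open>e\<close> tend to \<open>0\<close>.\<close>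
lemma op_abs_Cauchy_Schwarz:
  assumes R: "symmetric R"
  shows "inner (R \<cdot> u) v \<le> norm (op_sqrt (op_abs R) \<cdot> u) * norm (op_sqrt (op_abs R) \<cdot> v)"
proof -
  let ?B = "op_abs R" and ?N = "norm u * norm v"
  let ?K = "op_sqrt ?B"
  have B: "pos ?B" by (rule pos_op_abs[OF R])
  have RB: "R * ?B = ?B * R"
    unfolding op_abs_def by (rule op_sqrt_commute[OF pos_square[OF R]]) (simp add: mult.assoc)
  have RK: "R * ?K = ?K * R"
    by (rule op_sqrt_commute[OF B RB])
  have "inner (R \<cdot> u) v \<le> norm (?K \<cdot> u) * norm (?K \<cdot> v) + e * ?N" if e: "e > 0" for e
  proof -
    obtain G where G: "(?B + e *\<^sub>R 1) * G = 1" "G * (?B + e *\<^sub>R 1) = 1"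
      using pos_shift_inverse[OF B e] .
    have "?K * ?B = ?B * ?K" using op_sqrt_commute[OF B refl] by simp
    then have KP: "?K * (?B + e *\<^sub>R 1) = (?B + e *\<^sub>R 1) * ?K" by (simp add: algebra_simps)
    have "?K * G = (G * (?B + e *\<^sub>R 1)) * (?K * G)" by (simp add: G)
    also have "\<dots> = G * (?K * (?B + e *\<^sub>R 1)) * G" unfolding KP by (simp only: mult.assoc)
    also have "\<dots> = G * ?K" by (simp add: mult.assoc G)
    finally have KG: "?K * G = G * ?K" .
    have "R = R * ((?B + e *\<^sub>R 1) * G)" by (simp add: G)
    also have "\<dots> = R * (?K * ?K * G) + e *\<^sub>R (R * G)"
      by (simp add: op_sqrt_square[OF B] algebra_simps)
    also have "R * (?K * ?K * G) = ?K * (R * G) * ?K"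
      using KG RK by (metis mult.assoc)
    finally have "inner (R \<cdot> u) v = inner ((?K * (R * G) * ?K + e *\<^sub>R (R * G)) \<cdot> u) v" by simp
    also have "\<dots> = inner ((R * G) \<cdot> ?K \<cdot> u) (?K \<cdot> v) + e * inner ((R * G) \<cdot> u) v"
      using symmetricD[OF pos_symmetric[OF pos_op_sqrt[OF B]]] by (simp add: inner_add_left)
    also have "\<dots> \<le> norm (?K \<cdot> u) * norm (?K \<cdot> v) + e * ?N"
    proof -
      have "inner ((R * G) \<cdot> w) w' \<le> norm w * norm w'" for w w'
        using norm_cauchy_schwarz[of "(R * G) \<cdot> w" w'] norm_ge_zero[of w']
          mult_right_mono[OF sign_contraction[OF R less_imp_le[OF e] G(1), of w]]
        by fastforce
      then show ?thesis using e by (intro add_mono mult_left_mono) simp_all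
    qed
    finally show ?thesis .
  qed
  then show ?thesis by (rule le_of_le_add_epsilon_mult) simp_all
qed

section \<open>Hilbert--Schmidt sums and the trace norm of a sandwich\<close>

text \<open>The square of the Hilbert--Schmidt norm of \<open>Y\<close> is at most \<open>h\<close>. Phrasing this with finite sums
  includes the statement that the norm is finite.\<close>
definition hs_le :: "'i op \<Rightarrow> real \<Rightarrow> bool"
  where "hs_le Y h \<longleftrightarrow> (\<forall>F. finite F \<longrightarrow> (\<Sum>n\<in>F. (norm (Y \<cdot> delta n))\<^sup>2) \<le> h)"

definition adjoint_pair :: "'i op \<Rightarrow> 'i op \<Rightarrow> bool"
  where "adjoint_pair Y Z \<longleftrightarrow> (\<forall>u v. inner (Y \<cdot> u) v = inner u (Z \<cdot> v))"

lemma adjoint_pair_coord: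
  assumes "adjoint_pair Y Z"
  shows "coord (Y \<cdot> delta n) m = cnj (coord (Z \<cdot> delta m) n)"
proof -
  have adj: "cinner (Y \<cdot> u) v = cinner u (Z \<cdot> v)" for u v
  proof -
    have "cinner (Y \<cdot> u) v = Complex (inner (Y \<cdot> u) v) (inner (Y \<cdot> (\<i> *\<^sub>C u)) v)"
      by (simp only: cinner_eq_inner app_scaleC)
    also have "\<dots> = Complex (inner u (Z \<cdot> v)) (inner (\<i> *\<^sub>C u) (Z \<cdot> v))"
      using assms unfolding adjoint_pair_def by (simp only:)
    also have "\<dots> = cinner u (Z \<cdot> v)"
      by (simp only: cinner_eq_inner)
    finally show ?thesis .
  qed
  have "coord (Y \<cdot> delta n) m = cinner (delta m) (Y \<cdot> delta n)"
    by (rule cinner_delta_left[symmetric])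
  also have "\<dots> = cnj (cinner (Y \<cdot> delta n) (delta m))"
    by (rule cinner_cnj)
  also have "\<dots> = cnj (coord (Z \<cdot> delta m) n)"
    by (simp only: adj cinner_delta_left)
  finally show ?thesis .
qed

text \<open>The matrices of \<open>Y\<close> and \<open>Z\<close> are conjugate transposes of each other, so finite blocks of both have
  the same sum of squares; only their rows and columns are exchanged.\<close>
lemma hs_le_adjoint:
  assumes adj: "adjoint_pair Y Z" and "hs_le Z h"
  shows "hs_le Y h"
  unfolding hs_le_def
proof (intro allI impI)
  fix F :: "'a set" assume F: "finite F"
  let ?y = "\<lambda>n m. (cmod (coord (Y \<cdot> delta n) m))\<^sup>2"
  have "(\<Sum>m\<in>H. \<Sum>n\<in>F. ?y n m) \<le> h" if "finite H" for H
  proof -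
    have "(\<Sum>m\<in>H. \<Sum>n\<in>F. ?y n m) = (\<Sum>m\<in>H. \<Sum>n\<in>F. (cmod (coord (Z \<cdot> delta m) n))\<^sup>2)"
      by (simp only: adjoint_pair_coord[OF adj] complex_mod_cnj)
    also have "\<dots> \<le> (\<Sum>m\<in>H. (norm (Z \<cdot> delta m))\<^sup>2)"
      by (intro sum_mono sum_coord_le_norm F)
    also have "\<dots> \<le> h" using assms(2) that by (simp add: hs_le_def)
    finally show ?thesis .
  qed
  then have le: "(\<Sum>m\<in>H. \<Sum>n\<in>F. ?y n m) \<le> h" if "finite H" "H \<subseteq> UNIV" for H
    using that by blast
  have sums: "((\<lambda>m. \<Sum>n\<in>F. ?y n m) has_sum (\<Sum>n\<in>F. (norm (Y \<cdot> delta n))\<^sup>2)) UNIV"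
    using F
  proof (induction F rule: finite_induct)
    case (insert n F)
    have "(?y n has_sum (norm (Y \<cdot> delta n))\<^sup>2) UNIV"
      unfolding norm_eq_infsum by (rule has_sum_infsum[OF square_summable_coord])
    from has_sum_add[OF this insert.IH] show ?case
      using insert.hyps by simp
  qed simp
  show "(\<Sum>n\<in>F. (norm (Y \<cdot> delta n))\<^sup>2) \<le> h"
    by (rule has_sum_le_finite_sums[OF sums le])
qed

lemma hs_le_contraction:
  assumes "adjoint_pair U V" "\<And>u. norm (U \<cdot> u) \<le> norm u" "hs_le Y h"
  shows "hs_le (V * Y) h"
  unfolding hs_le_def
proof (intro allI impI)
  fix F :: "'a set" assume "finite F"
  have contr: "norm (V \<cdot> w) \<le> norm w" for w
  proof -
    have "norm (V \<cdot> w) * norm (V \<cdot> w) = inner (V \<cdot> w) (V \<cdot> w)"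
      by (metis power2_eq_square power2_norm_eq_inner)
    also have "\<dots> = inner (U \<cdot> V \<cdot> w) w"
      using assms(1) by (simp add: adjoint_pair_def)
    also have "\<dots> \<le> norm (U \<cdot> V \<cdot> w) * norm w" by (rule norm_cauchy_schwarz)
    also have "\<dots> \<le> norm (V \<cdot> w) * norm w" by (intro mult_right_mono assms(2)) simp
    finally show ?thesis by (cases "norm (V \<cdot> w) = 0") auto
  qed
  have "(\<Sum>n\<in>F. (norm ((V * Y) \<cdot> delta n))\<^sup>2) \<le> (\<Sum>n\<in>F. (norm (Y \<cdot> delta n))\<^sup>2)"
    by (intro sum_mono power_mono) (simp_all add: contr)
  also have "\<dots> \<le> h" using assms(3) \<open>finite F\<close> by (simp add: hs_le_def)
  finally show "(\<Sum>n\<in>F. (norm ((V * Y) \<cdot> delta n))\<^sup>2) \<le> h" .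
qed

text \<open>The diagonal of \<open>\<bar>A\<bar>\<close> is compared with that of \<open>A U\<close> for the contraction \<open>U = A (\<bar>A\<bar> + e)\<^sup>-\<^sup>1\<close>.
  Its entries \<open>\<langle>R S \<delta>\<^sub>n, S U \<delta>\<^sub>n\<rangle>\<close> are bounded by the Cauchy--Schwarz inequality for \<open>R\<close>, and
  \<open>K S U\<close> is controlled by its adjoint \<open>U\<^sup>* S K\<close>, where the contraction acts from the left.\<close>
lemma sum_op_abs_sandwich_le:
  fixes R S :: "'i op"
  defines "K \<equiv> op_sqrt (op_abs R)" and "M \<equiv> op_abs (S * R * S)"
  assumes R: "symmetric R" and S: "symmetric S" and h: "hs_le (K * S) h" and F: "finite F"
  shows "(\<Sum>n\<in>F. inner (delta n) (M \<cdot> delta n)) \<le> h"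
proof -
  define A where "A = S * R * S"
  have A: "symmetric A" unfolding A_def by (rule symmetric_sandwich[OF R S])
  have K: "symmetric K" unfolding K_def by (intro pos_symmetric pos_op_sqrt pos_op_abs R)
  have M: "M = op_abs A" by (simp add: M_def A_def)
  have posM: "pos M" unfolding M by (rule pos_op_abs[OF A])
  have "(\<Sum>n\<in>F. inner (delta n) (M \<cdot> delta n)) \<le> h + e * real (card F)" if e: "e > 0" for e
  proof -
    obtain G where G: "(M + e *\<^sub>R 1) * G = 1" "G * (M + e *\<^sub>R 1) = 1"
      using pos_shift_inverse[OF posM e] .
    let ?P = "M + e *\<^sub>R 1"
    have symP: "symmetric ?P" by (intro symmetric_algebra pos_symmetric posM)
    have PG: "?P \<cdot> G \<cdot> u = u" for u
      using G(1) by (metis app_simps(2,3))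
    have symG: "symmetric G"
      unfolding symmetric_def using symmetricD[OF symP] PG by metis
    have posG: "0 \<le> inner u (G \<cdot> u)" for u
    proof -
      have "inner u (G \<cdot> u) = inner (G \<cdot> u) (M \<cdot> G \<cdot> u) + e * inner (G \<cdot> u) (G \<cdot> u)"
        using PG[of u] by (metis app_simps(2,4,7) inner_add_right inner_scaleR_right inner_commute)
      then show ?thesis using posD[OF posM] that by simp
    qed
    define U where "U = A * G"
    have contr: "norm (U \<cdot> u) \<le> norm u" for u
      unfolding U_def using sign_contraction[OF A less_imp_le[OF that]] G(1) M by blast
    have adjU: "adjoint_pair U (G * A)"
      using symmetricD[OF A] symmetricD[OF symG] by (simp add: adjoint_pair_def U_def)
    have "hs_le (S * K) h"
      using h by (rule hs_le_adjoint[rotated]) (simp add: adjoint_pair_def symmetricD K S)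
    then have "hs_le (G * A * (S * K)) h"
      by (rule hs_le_contraction[OF adjU contr])
    then have hU: "hs_le (K * S * U) h"
      by (rule hs_le_adjoint[rotated]) (use adjU in \<open>simp add: adjoint_pair_def symmetricD K S\<close>)
    have "inner (delta n) (M \<cdot> delta n) - e
        \<le> ((norm ((K * S) \<cdot> delta n))\<^sup>2 + (norm ((K * S * U) \<cdot> delta n))\<^sup>2) / 2" for n
    proof -
      let ?d = "delta n"
      \<comment> \<open>\<open>M\<^sup>2 (M + e)\<^sup>-\<^sup>1 = M - e + e\<^sup>2 (M + e)\<^sup>-\<^sup>1\<close>, and the last summand is positive.\<close>
      have "A * U = M * (M * G)"
        using op_abs_square[OF A] by (simp add: U_def M mult.assoc[symmetric])
      moreover have MG: "M * G = 1 - e *\<^sub>R G" using G(1) by (simp add: algebra_simps)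
      ultimately have "A * U = M - e *\<^sub>R 1 + e\<^sup>2 *\<^sub>R G"
        by (simp add: right_diff_distrib power2_eq_square scaleR_right_diff_distrib)
      then have "inner ?d (M \<cdot> ?d) - e + e\<^sup>2 * inner ?d (G \<cdot> ?d) = inner ?d ((A * U) \<cdot> ?d)"
        by (simp add: inner_add_right inner_diff_right flip: power2_norm_eq_inner)
      also have "\<dots> = inner (A \<cdot> ?d) (U \<cdot> ?d)"
        by (simp add: symmetricD[OF A])
      also have "\<dots> = inner (R \<cdot> S \<cdot> ?d) (S \<cdot> U \<cdot> ?d)"
        by (simp add: A_def symmetricD[OF S])
      also have "\<dots> \<le> norm ((K * S) \<cdot> ?d) * norm ((K * S * U) \<cdot> ?d)"
        using op_abs_Cauchy_Schwarz[OF R] by (simp add: K_def)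
      also have "\<dots> \<le> ((norm ((K * S) \<cdot> ?d))\<^sup>2 + (norm ((K * S * U) \<cdot> ?d))\<^sup>2) / 2"
        using sum_squares_bound[of "norm ((K * S) \<cdot> ?d)" "norm ((K * S * U) \<cdot> ?d)"] by simp
      finally show ?thesis
        using mult_nonneg_nonneg[OF zero_le_power2[of e] posG[of ?d]] by linarith
    qed
    then have "(\<Sum>n\<in>F. inner (delta n) (M \<cdot> delta n) - e)
        \<le> (\<Sum>n\<in>F. ((norm ((K * S) \<cdot> delta n))\<^sup>2 + (norm ((K * S * U) \<cdot> delta n))\<^sup>2) / 2)"
      by (rule sum_mono)
    also have "\<dots> \<le> h"
    proof -
      have "(\<Sum>n\<in>F. (norm ((K * S) \<cdot> delta n))\<^sup>2) \<le> h" "(\<Sum>n\<in>F. (norm ((K * S * U) \<cdot> delta n))\<^sup>2) \<le> h"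
        using h hU F unfolding hs_le_def by blast+
      from add_mono[OF this] show ?thesis
        by (simp add: sum.distrib del: app_simps flip: sum_divide_distrib)
    qed
    finally show ?thesis by (simp add: sum_subtractf mult.commute)
  qed
  then show ?thesis by (rule le_of_le_add_epsilon_mult) simp_all
qed

lemma trace_norm_app:
  "symmetric A \<Longrightarrow> trace_norm (app A) = (\<Sum>\<^sub>\<infinity>n. ennreal (inner (delta n) (op_abs A \<cdot> delta n)))"
  by (simp add: trace_norm_def abs_op_app inner_ell2_def)

lemma ennreal_infsum_le:
  assumes "\<And>F. finite F \<Longrightarrow> (\<Sum>n\<in>F. f n) \<le> h" "\<And>n. 0 \<le> f n"
  shows "(\<Sum>\<^sub>\<infinity>n. ennreal (f n)) \<le> ennreal h"
  unfolding nonneg_infsum_complete[of UNIV "\<lambda>n. ennreal (f n)", simplified]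
  by (rule SUP_least) (auto simp: assms sum_ennreal intro!: ennreal_leI)

lemma trace_norm_sandwich_le:
  assumes R: "symmetric R" and S: "symmetric S" and h: "hs_le (op_sqrt (op_abs R) * S) h"
  shows "trace_norm (app (S * R * S)) \<le> ennreal h"
proof -
  have A: "symmetric (S * R * S)" by (rule symmetric_sandwich[OF R S])
  show ?thesis
    unfolding trace_norm_app[OF A]
    by (rule ennreal_infsum_le) (use sum_op_abs_sandwich_le[OF R S h] posD[OF pos_op_abs[OF A]] in auto)
qed

section \<open>Resolvents at real points\<close>

definition inverse_pair :: "'i op \<Rightarrow> 'i op \<Rightarrow> bool"
  where "inverse_pair A R \<longleftrightarrow> A * R = 1 \<and> R * A = 1"

lemma app_shift: "app (A - x *\<^sub>R 1) = (\<lambda>u. A \<cdot> u - complex_of_real x *\<^sub>C u)"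
  by (simp add: fun_eq_iff scaleC_of_real)

lemma resolvent_eq:
  assumes "inverse_pair (A - x *\<^sub>R 1) R"
  shows "complex_of_real x \<notin> spectrum (app A)" "resolvent (app A) (complex_of_real x) = app R"
proof -
  have AR: "(A - x *\<^sub>R 1) \<cdot> R \<cdot> u = u" "R \<cdot> (A - x *\<^sub>R 1) \<cdot> u = u" for u
    using assms unfolding inverse_pair_def by (metis app_simps(2,3))+
  have bij: "bij (app (A - x *\<^sub>R 1))"
    by (rule bij_betw_byWitness[where f' = "app R"]) (use AR in auto)
  have "inv (app (A - x *\<^sub>R 1)) = app R"
    by (rule inv_equality[where f = "app (A - x *\<^sub>R 1)"]; rule AR)
  then show res: "resolvent (app A) (complex_of_real x) = app R"
    by (simp only: resolvent_def app_shift)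
  show "complex_of_real x \<notin> spectrum (app A)"
    unfolding spectrum_def using bij res app_shift[of A x] by simp
qed

lemma inverse_pair_of_resolvent:
  assumes "complex_of_real x \<notin> spectrum (app A)"
  obtains R where "inverse_pair (A - x *\<^sub>R 1) R" "resolvent (app A) (complex_of_real x) = app R"
proof -
  let ?R = "op_of (resolvent (app A) (complex_of_real x))"
  have bij: "bij (app (A - x *\<^sub>R 1))"
    and bc: "bounded_clinear (resolvent (app A) (complex_of_real x))"
    using assms unfolding spectrum_def app_shift by auto
  have R: "app ?R = inv (app (A - x *\<^sub>R 1))"
    unfolding app_op_of[OF bc] by (simp only: resolvent_def app_shift)
  have "inverse_pair (A - x *\<^sub>R 1) ?R"
    unfolding inverse_pair_def
    by (intro conjI op_eqI)
       (simp_all only: app_simps(2,3) R surj_f_inv_f[OF bij_is_surj[OF bij]] inv_f_f[OF bij_is_inj[OF bij]])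
  then show thesis using that app_op_of[OF bc] by metis
qed

lemma symmetric_inverse:
  assumes "symmetric A" "inverse_pair A R"
  shows "symmetric R"
proof -
  have "A \<cdot> R \<cdot> u = u" for u
    using assms(2) unfolding inverse_pair_def by (metis app_simps(2,3))
  then show ?thesis
    unfolding symmetric_def using symmetricD[OF assms(1)] by metis
qed

text \<open>\<open>A - x - h = (A - x) (1 - h R)\<close>, and the second factor is inverted by the Neumann series.\<close>
lemma inverse_pair_perturb:
  assumes "inverse_pair (A - x *\<^sub>R 1) R" "\<bar>h\<bar> * norm R < 1"
  obtains R' where "inverse_pair (A - (x + h) *\<^sub>R 1) R'" "(\<lambda>k. h ^ k *\<^sub>R R ^ Suc k) sums R'"
proof -
  let ?P = "A - x *\<^sub>R 1"
  have PR: "?P * R = 1" "R * ?P = 1" using assms(1) by (simp_all add: inverse_pair_def)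
  have "norm (h *\<^sub>R R) < 1" using assms(2) by simp
  then obtain g where g: "(\<lambda>k. (h *\<^sub>R R) ^ k) sums g" "(1 - h *\<^sub>R R) * g = 1" "g * (1 - h *\<^sub>R R) = 1"
    by (rule neumann_series)
  have shift: "A - (x + h) *\<^sub>R 1 = ?P - h *\<^sub>R 1" by (simp add: algebra_simps)
  have "Q - h *\<^sub>R 1 = Q * (1 - h *\<^sub>R R) \<and> Q - h *\<^sub>R 1 = (1 - h *\<^sub>R R) * Q" if "Q * R = 1" "R * Q = 1" for Q
    using that by (simp add: right_diff_distrib left_diff_distrib)
  note fac = this[OF PR, THEN conjunct1] this[OF PR, THEN conjunct2]
  have gR: "g * R = R * g"
    by (rule commute_sums[OF g(1), symmetric]) (rule power_commuting_commutes[symmetric], simp)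
  have "(?P - h *\<^sub>R 1) * (g * R) = ?P * ((1 - h *\<^sub>R R) * g) * R"
    unfolding fac(1) by (simp only: mult.assoc)
  then have 1: "(?P - h *\<^sub>R 1) * (g * R) = 1" using g PR by simp
  have "(g * R) * (?P - h *\<^sub>R 1) = g * (R * ?P) * (1 - h *\<^sub>R R)"
    unfolding fac(1) by (simp only: mult.assoc)
  then have 2: "(g * R) * (?P - h *\<^sub>R 1) = 1" using g PR by simp
  have "(\<lambda>k. (h *\<^sub>R R) ^ k * R) sums (g * R)"
    by (rule bounded_linear.sums[OF bounded_linear_mult_left g(1)])
  moreover have "(h *\<^sub>R R) ^ k * R = h ^ k *\<^sub>R R ^ Suc k" for k
    by (simp only: scaleR_power mult_scaleR_left power_Suc2)
  ultimately have "(\<lambda>k. h ^ k *\<^sub>R R ^ Suc k) sums (g * R)" by (simp only:)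
  then show thesis
    by (rule that[rotated]) (simp only: inverse_pair_def shift 1 2)
qed

text \<open>The series are assumed to agree on a real interval only. Once the first \<open>n\<close> coefficients agree,
  the difference divided by \<open>h\<^sup>n\<close> is a power series that vanishes for \<open>h \<noteq> 0\<close>, so its limit at \<open>0\<close>,
  the difference of the coefficients of index \<open>n\<close>, vanishes as well.\<close>
lemma powser_unique:
  fixes a b :: "nat \<Rightarrow> real"
  assumes r: "r > 0"
    and a: "\<And>h. \<bar>h\<bar> < r \<Longrightarrow> (\<lambda>k. a k * h ^ k) sums f h"
    and b: "\<And>h. \<bar>h\<bar> < r \<Longrightarrow> (\<lambda>k. b k * h ^ k) sums f h"
  shows "a = b"
proof -
  have "a n - b n = 0" for n
  proof (induction n rule: less_induct)
    case (less n)
    have "((\<lambda>_. 0) \<longlongrightarrow> a (0 + n) - b (0 + n)) (at (0 :: real))"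
    proof (rule powser_limit_0_strong[OF r])
      fix h :: real assume h: "h \<noteq> 0" "norm h < r"
      then have "(\<lambda>k. (a k - b k) * h ^ k) sums 0"
        using sums_diff[OF a[of h] b[of h]] by (simp add: left_diff_distrib)
      from sums_split_initial_segment[OF this, of n]
      have "(\<lambda>k. (a (k + n) - b (k + n)) * h ^ (k + n)) sums 0"
        using less.IH by simp
      from sums_mult[OF this, of "1 / h ^ n"]
      show "(\<lambda>k. (a (k + n) - b (k + n)) * h ^ k) sums 0"
        using h by (simp add: power_add)
    qed
    from tendsto_unique[OF _ this tendsto_const] show ?case by simp
  qed
  then show ?thesis by (simp add: fun_eq_iff)
qed

lemma closed_real_spectrum: "closed (real_spectrum (app A))"
proof -
  have "open (- real_spectrum (app A))"
    unfolding open_real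
  proof
    fix x assume "x \<in> - real_spectrum (app A)"
    then obtain R where R: "inverse_pair (A - x *\<^sub>R 1) R"
      using inverse_pair_of_resolvent[of x A] by (auto simp: real_spectrum_def)
    show "\<exists>e>0. \<forall>y. \<bar>y - x\<bar> < e \<longrightarrow> y \<in> - real_spectrum (app A)"
    proof (intro exI conjI allI impI)
      show "1 / (norm R + 1) > 0" by (simp add: add_nonneg_pos)
      fix y assume "\<bar>y - x\<bar> < 1 / (norm R + 1)"
      then have "\<bar>y - x\<bar> * (norm R + 1) < 1"
        by (subst (asm) pos_less_divide_eq) (simp_all add: add_nonneg_pos)
      then have "\<bar>y - x\<bar> * norm R < 1" by (simp add: algebra_simps)
      from inverse_pair_perturb[OF R this] resolvent_eq(1)[of A y]
      show "y \<in> - real_spectrum (app A)" by (auto simp: real_spectrum_def)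
    qed
  qed
  then show ?thesis by (simp add: closed_def)
qed

section \<open>Spectral measures and the modulus of the resolvent\<close>

text \<open>Cutting \<open>1 / (t - x)\<close> off outside the spectrum makes it bounded everywhere, and not merely almost
  everywhere for the spectral measures.\<close>
definition recip_on :: "real set \<Rightarrow> real \<Rightarrow> real \<Rightarrow> real"
  where "recip_on E x t = (if t \<in> E then 1 / (t - x) else 0)"

text \<open>A point at distance less than \<open>1 / norm R\<close> from \<open>x\<close> is not in the spectrum, by the perturbation
  of the inverse.\<close>
lemma recip_on_bound:
  assumes R: "inverse_pair (A - x *\<^sub>R 1) R"
  shows "\<bar>recip_on (real_spectrum (app A)) x t\<bar> \<le> norm R"
proof (cases "t \<in> real_spectrum (app A)")
  case True
  then have "\<not> \<bar>t - x\<bar> * norm R < 1"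
    using inverse_pair_perturb[OF R, of "t - x"] resolvent_eq(1)[of A t] by (auto simp: real_spectrum_def)
  moreover from this have "\<bar>t - x\<bar> > 0" by auto
  ultimately have "1 / \<bar>t - x\<bar> \<le> norm R" by (simp add: pos_divide_le_eq mult.commute)
  then show ?thesis using True by (simp add: recip_on_def)
qed (simp add: recip_on_def)

lemma recip_on_measurable:
  assumes "closed E"
  shows "recip_on E x \<in> borel_measurable borel"
proof -
  have "E \<in> sets borel" using assms by (rule borel_closed)
  then show ?thesis unfolding recip_on_def by measurable
qed

text \<open>With \<open>s = 1 / (t - x)\<close>, both \<open>\<langle>\<delta>\<^sub>n, (A - x - h)\<^sup>-\<^sup>1 \<delta>\<^sub>n\<rangle>\<close> and \<open>\<integral> s / (1 - h s) d\<rho>\<close> are power series in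
  \<open>h\<close>, by the Neumann series and by a geometric series integrated term by term. The Herglotz
  representation says that they agree for small \<open>h\<close>, so their coefficients agree.\<close>
lemma resolvent_moments:
  assumes R: "inverse_pair (A - x *\<^sub>R 1) R" and \<rho>: "is_spectral_measure (app A) n \<rho>"
  shows "inner (delta n) (R ^ Suc k \<cdot> delta n) = (\<integral>t. recip_on (real_spectrum (app A)) x t ^ Suc k \<partial>\<rho>)"
proof -
  define E where "E = real_spectrum (app A)"
  define s where "s = recip_on E x"
  define r where "r = norm R"
  have sets [measurable_cong]: "sets \<rho> = sets borel" and "finite_measure \<rho>"
    and rep: "\<And>z. z \<notin> spectrum (app A) \<Longrightarrow> cinner (delta n) (resolvent (app A) z (delta n)) =
          (LINT t:E|\<rho>. 1 / (complex_of_real t - z))"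
    using \<rho> by (auto simp: is_spectral_measure_def E_def)
  interpret finite_measure \<rho> by fact
  have [measurable]: "s \<in> borel_measurable borel"
    unfolding s_def E_def by (intro recip_on_measurable closed_real_spectrum)
  have s: "\<bar>s t\<bar> \<le> r" for t
    unfolding s_def E_def r_def by (rule recip_on_bound[OF R])
  have r0: "0 \<le> r" by (simp add: r_def)
  let ?m = "\<lambda>k. inner (delta n) (R ^ Suc k \<cdot> delta n)" and ?\<mu> = "\<lambda>k. \<integral>t. s t ^ Suc k \<partial>\<rho>"
  let ?f = "\<lambda>h. \<integral>t. s t / (1 - h * s t) \<partial>\<rho>"
  have "?m = ?\<mu>"
  proof (rule powser_unique)
    show "1 / (r + 1) > 0" using r0 by simp
    fix h :: real assume "\<bar>h\<bar> < 1 / (r + 1)"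
    then have "\<bar>h\<bar> * (r + 1) < 1" using r0 by (simp add: field_simps)
    then have hr: "\<bar>h\<bar> * r < 1" by (simp add: algebra_simps)
    have hs: "\<bar>h * s t\<bar> < 1" for t
      using mult_left_mono[OF s[of t] abs_ge_zero[of h]] hr by (simp add: abs_mult)
    obtain R' where R': "inverse_pair (A - (x + h) *\<^sub>R 1) R'" "(\<lambda>k. h ^ k *\<^sub>R R ^ Suc k) sums R'"
      using inverse_pair_perturb[OF R] hr unfolding r_def by metis
    have "complex_of_real (inner (delta n) (R' \<cdot> delta n)) = complex_of_real (?f h)"
    proof -

      have "(LINT t:E|\<rho>. 1 / (complex_of_real t - complex_of_real (x + h)))
          = (LINT t|\<rho>. complex_of_real (s t / (1 - h * s t)))"
        unfolding set_lebesgue_integral_def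
      proof (rule Bochner_Integration.integral_cong[OF refl])
        fix t
        show "indicat_real E t *\<^sub>R (1 / (complex_of_real t - complex_of_real (x + h)))
            = complex_of_real (s t / (1 - h * s t))"
        proof (cases "t \<in> E \<and> t \<noteq> x")
          case True
          then have "s t / (1 - h * s t) = 1 / (t - (x + h))"
            by (simp add: s_def recip_on_def field_simps)
          moreover have "1 / (complex_of_real t - complex_of_real (x + h)) = complex_of_real (1 / (t - (x + h)))"
            by (simp only: of_real_divide of_real_diff of_real_1)
          ultimately show ?thesis using True by (simp only: indicator_simps(1) scaleR_one)
        next
          case False
          have "x \<notin> E"
            using resolvent_eq(1)[OF R] by (simp add: E_def real_spectrum_def)
          then show ?thesis using False by (auto simp: s_def recip_on_def)
        qed
      qed
      also have "\<dots> = complex_of_real (?f h)" by (rule integral_complex_of_real)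
      finally have "cinner (delta n) (R' \<cdot> delta n) = complex_of_real (?f h)"
        using rep[OF resolvent_eq(1)[OF R'(1)]] resolvent_eq(2)[OF R'(1)] by simp
      then show ?thesis by (simp add: inner_ell2_def)
    qed
    then have R'f: "inner (delta n) (R' \<cdot> delta n) = ?f h" by (simp only: of_real_eq_iff)
    show "(\<lambda>k. ?m k * h ^ k) sums ?f h"
      using inner_sums_op[OF R'(2), of "delta n" "delta n"] by (simp add: R'f mult.commute)
    have bnd: "\<bar>h ^ k * s t ^ Suc k\<bar> \<le> (\<bar>h\<bar> * r) ^ k * r" for k t
    proof -
      have "\<bar>h ^ k * s t ^ Suc k\<bar> = (\<bar>h\<bar> * \<bar>s t\<bar>) ^ k * \<bar>s t\<bar>"
        by (simp add: abs_mult power_abs power_mult_distrib)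
      also have "\<dots> \<le> (\<bar>h\<bar> * r) ^ k * r"
        by (intro mult_mono power_mono mult_left_mono s) (auto simp: r0)
      finally show ?thesis .
    qed
    have geo: "(\<lambda>k. h ^ k * s t ^ Suc k) sums (s t / (1 - h * s t))" for t
      using sums_mult2[OF geometric_sums[of "h * s t"], of "s t"] hs[of t]
      by (simp add: power_mult_distrib mult_ac)
    have int: "integrable \<rho> (\<lambda>t. h ^ k * s t ^ Suc k)" for k
      by (rule integrable_const_bound[where B = "(\<bar>h\<bar> * r) ^ k * r"]) (use bnd in auto)
    have sumg: "summable (\<lambda>k. (\<bar>h\<bar> * r) ^ k * r)"
      using hr r0 by (intro summable_mult2 summable_geometric) simp
    have "(\<lambda>k. \<integral>t. h ^ k * s t ^ Suc k \<partial>\<rho>) sums (\<integral>t. (\<Sum>k. h ^ k * s t ^ Suc k) \<partial>\<rho>)"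
    proof (rule sums_integral[OF int])
      show "AE t in \<rho>. summable (\<lambda>k. norm (h ^ k * s t ^ Suc k))"
        by (intro AE_I2 summable_comparison_test'[OF sumg]) (use bnd in auto)
      show "summable (\<lambda>k. \<integral>t. norm (h ^ k * s t ^ Suc k) \<partial>\<rho>)"
      proof (rule summable_comparison_test'[OF summable_mult2[OF sumg, of "measure \<rho> (space \<rho>)"]])
        fix k
        have "(\<integral>t. norm (h ^ k * s t ^ Suc k) \<partial>\<rho>) \<le> (\<integral>t. (\<bar>h\<bar> * r) ^ k * r \<partial>\<rho>)"
          by (intro integral_mono integrable_norm int) (use bnd in auto)
        then show "norm (\<integral>t. norm (h ^ k * s t ^ Suc k) \<partial>\<rho>) \<le> (\<bar>h\<bar> * r) ^ k * r * measure \<rho> (space \<rho>)"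
          by (simp add: mult_ac)
      qed
    qed
    also have "(\<integral>t. (\<Sum>k. h ^ k * s t ^ Suc k) \<partial>\<rho>) = ?f h"
      using sums_unique[OF geo] by simp
    finally show "(\<lambda>k. ?\<mu> k * h ^ k) sums ?f h" by (simp add: mult.commute)
  qed
  then show ?thesis by (simp add: fun_eq_iff s_def E_def)
qed

text \<open>This bound ensures that the constant \<open>norm (R * R) + 1\<close> used to scale \<open>R\<^sup>2\<close> also dominates
  \<open>1 / (t - x)\<^sup>2\<close> on the spectrum.\<close>
lemma norm_symmetric_square_ge:
  assumes "symmetric R"
  shows "(norm R)\<^sup>2 \<le> norm (R * R)"
proof -
  have "norm R \<le> sqrt (norm (R * R))"
  proof (rule norm_op_le)
    fix u
    have "(norm (R \<cdot> u))\<^sup>2 = inner u ((R * R) \<cdot> u)"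
      by (simp add: power2_norm_eq_inner symmetricD[OF assms])
    also have "\<dots> \<le> norm (R * R) * (norm u)\<^sup>2"
      using inner_app_le[of u "R * R" u] by (simp add: power2_eq_square)
    finally show "norm (R \<cdot> u) \<le> sqrt (norm (R * R)) * norm u"
      using real_le_rsqrt by (fastforce simp: real_sqrt_mult)
  qed simp
  from power_mono[OF this norm_ge_zero, of 2] show ?thesis by simp
qed

text \<open>Put \<open>X = 1 - R\<^sup>2 / c\<close> and \<open>y = 1 - s\<^sup>2 / c\<close>. The operator \<open>\<bar>R\<bar>\<close> is \<open>c\<^sup>1\<^sup>/\<^sup>2\<close> times the binomial
  series in \<open>X\<close>, which is also a series in \<open>1 - X\<^sup>j\<close> because the coefficients sum to \<open>0\<close>. Each \<open>1 - X\<^sup>j\<close>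
  is a polynomial in \<open>R\<close> without constant term, so its diagonal entry is \<open>\<integral> (1 - y\<^sup>j) d\<rho>\<close> by the
  moment formula. Under the integral sign every partial sum is at most
  \<open>(1 - y)\<^sup>1\<^sup>/\<^sup>2 = \<bar>s\<bar> / c\<^sup>1\<^sup>/\<^sup>2\<close>.\<close>
lemma op_abs_resolvent_diag_le:
  assumes R: "inverse_pair (A - x *\<^sub>R 1) R" and sym: "symmetric R"
    and \<rho>: "is_spectral_measure (app A) n \<rho>"
  shows "inner (delta n) (op_abs R \<cdot> delta n) \<le> (\<integral>t. \<bar>recip_on (real_spectrum (app A)) x t\<bar> \<partial>\<rho>)"
proof -
  define s where "s = recip_on (real_spectrum (app A)) x"
  define c where "c = norm (R * R) + 1"
  define X where "X = 1 - (R * R) /\<^sub>R c"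
  define y where "y t = 1 - (s t)\<^sup>2 / c" for t
  let ?d = "delta n"
  have c: "c > 0" by (simp add: c_def add_nonneg_pos)
  have sets [measurable_cong]: "sets \<rho> = sets borel" and "finite_measure \<rho>"
    using \<rho> by (auto simp: is_spectral_measure_def)
  interpret finite_measure \<rho> by fact
  have [measurable]: "s \<in> borel_measurable borel"
    unfolding s_def by (intro recip_on_measurable closed_real_spectrum)
  have s: "\<bar>s t\<bar> \<le> norm R" for t
    unfolding s_def by (rule recip_on_bound[OF R])
  have s2: "(s t)\<^sup>2 \<le> c" for t
    using power_mono[OF s[of t] abs_ge_zero, of 2] norm_symmetric_square_ge[OF sym] by (simp add: c_def)
  then have y: "0 \<le> y t" "y t \<le> 1" for t
    using c by (simp_all add: y_def)
  have [measurable]: "y \<in> borel_measurable borel" unfolding y_def by measurable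
  have int: "integrable \<rho> (\<lambda>t. s t ^ k * y t ^ j)" for k j
  proof (rule integrable_const_bound[where B = "norm R ^ k"])
    show "AE t in \<rho>. norm (s t ^ k * y t ^ j) \<le> norm R ^ k"
    proof (rule AE_I2)
      fix t
      have "\<bar>s t\<bar> ^ k * \<bar>y t\<bar> ^ j \<le> norm R ^ k * 1"
        using y[of t] by (intro mult_mono power_mono s power_le_one) auto
      then show "norm (s t ^ k * y t ^ j) \<le> norm R ^ k" by (simp add: abs_mult power_abs)
    qed
  qed simp
  have mom: "inner ?d ((R ^ Suc k * X ^ j) \<cdot> ?d) = (\<integral>t. s t ^ Suc k * y t ^ j \<partial>\<rho>)" for j k
  proof (induction j arbitrary: k)
    case 0
    show ?case using resolvent_moments[OF R \<rho>, of k] by (simp add: s_def)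
  next
    case (Suc j)
    have "R ^ Suc k * X ^ Suc j = R ^ Suc k * (X * X ^ j)" by simp
    also have "\<dots> = R ^ Suc k * X ^ j - (R ^ Suc (k + 2) * X ^ j) /\<^sub>R c"
      by (simp add: X_def left_diff_distrib right_diff_distrib power_commutes mult.assoc)
        (simp flip: mult.assoc power_Suc power_Suc2)
    finally have "inner ?d ((R ^ Suc k * X ^ Suc j) \<cdot> ?d)
        = inner ?d ((R ^ Suc k * X ^ j) \<cdot> ?d) - inner ?d ((R ^ Suc (k + 2) * X ^ j) \<cdot> ?d) / c"
      by (simp only: app_simps inner_diff_right inner_scaleR_right) (simp add: field_simps)
    also have "\<dots> = (\<integral>t. s t ^ Suc k * y t ^ j - s t ^ Suc (k + 2) * y t ^ j / c \<partial>\<rho>)"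
      using Bochner_Integration.integral_diff[OF int[of "Suc k" j] integrable_divide_zero[OF int[of "Suc (k + 2)" j], of c]]
      by (simp only: Suc.IH integral_divide_zero)
    also have "\<dots> = (\<integral>t. s t ^ Suc k * y t ^ Suc j \<partial>\<rho>)"
      by (intro Bochner_Integration.integral_cong refl) (simp add: y_def algebra_simps power2_eq_square)
    finally show ?case .
  qed
  have int_gap: "integrable \<rho> (\<lambda>t. 1 - y t ^ j)" for j
    using int[of 0 0] int[of 0 j] by simp
  have gap: "inner ?d ((1 - X ^ j) \<cdot> ?d) = (\<integral>t. 1 - y t ^ j \<partial>\<rho>)" for j
  proof (induction j)
    case (Suc j)
    have "1 - X ^ Suc j = (1 - X ^ j) + (1 - X) * X ^ j" by (simp add: algebra_simps)
    also have "(1 - X) * X ^ j = (R ^ Suc 1 * X ^ j) /\<^sub>R c" by (simp add: X_def)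
    finally have "inner ?d ((1 - X ^ Suc j) \<cdot> ?d)
        = inner ?d ((1 - X ^ j) \<cdot> ?d) + inner ?d ((R ^ Suc 1 * X ^ j) \<cdot> ?d) / c"
      by (simp only: app_simps(4,7) inner_add_right inner_scaleR_right) (simp add: field_simps)
    also have "\<dots> = (\<integral>t. (1 - y t ^ j) + s t ^ Suc 1 * y t ^ j / c \<partial>\<rho>)"
      using Bochner_Integration.integral_add[OF int_gap[of j] integrable_divide_zero[OF int[of "Suc 1" j], of c]]
      by (simp only: Suc.IH mom integral_divide_zero)
    also have "\<dots> = (\<integral>t. 1 - y t ^ Suc j \<partial>\<rho>)"
      by (intro Bochner_Integration.integral_cong refl) (simp add: y_def algebra_simps power2_eq_square)
    finally show ?case .
  qed simp
  have normX: "norm X \<le> 1"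
    unfolding X_def c_def by (rule norm_sqrt_arg[OF pos_square[OF sym]])
  have "(\<lambda>j. rt_coeff j * inner ?d ?d - rt_coeff j * inner ?d (X ^ j \<cdot> ?d))
      sums (0 * inner ?d ?d - inner ?d (sqrt_1m X \<cdot> ?d))"
    using inner_sums_op[OF sqrt_1m_sums[OF normX], of ?d ?d]
    by (intro sums_diff sums_mult2 rt_coeff_sums_0) simp
  then have "(\<lambda>j. - (rt_coeff j * inner ?d ?d - rt_coeff j * inner ?d (X ^ j \<cdot> ?d)))
      sums (- (0 * inner ?d ?d - inner ?d (sqrt_1m X \<cdot> ?d)))"
    by (rule sums_minus)
  then have gaps: "(\<lambda>j. - rt_coeff j * inner ?d ((1 - X ^ j) \<cdot> ?d)) sums inner ?d (sqrt_1m X \<cdot> ?d)"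
    by (simp add: inner_diff_right algebra_simps)
  have sqrt_y: "sqrt (1 - y t) = \<bar>s t\<bar> / sqrt c" for t
    by (simp add: y_def real_sqrt_divide)
  have int_s: "integrable \<rho> (\<lambda>t. \<bar>s t\<bar>)" using integrable_abs[OF int[of 1 0]] by simp
  have "inner ?d (sqrt_1m X \<cdot> ?d) \<le> (\<integral>t. \<bar>s t\<bar> / sqrt c \<partial>\<rho>)"
  proof (rule LIMSEQ_le_const2[OF gaps[unfolded sums_def]], intro exI allI impI)
    fix N :: nat
    have "(\<Sum>j<N. - rt_coeff j * inner ?d ((1 - X ^ j) \<cdot> ?d)) = (\<integral>t. (\<Sum>j<N. - rt_coeff j * (1 - y t ^ j)) \<partial>\<rho>)"
      unfolding gap by (subst Bochner_Integration.integral_sum) (use int_gap in auto)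
    also have "\<dots> \<le> (\<integral>t. \<bar>s t\<bar> / sqrt c \<partial>\<rho>)"
    proof (rule integral_mono)
      fix t
      note sums = sums_rt_coeff_gap[OF y[of t]]
      have "0 \<le> - rt_coeff j * (1 - y t ^ j)" for j
        using rt_coeff_nonpos[of j] power_le_one[OF y, of t j] by (cases "j = 0") (auto simp: mult_nonpos_nonneg)
      from sum_le_suminf[OF sums_summable[OF sums] _ this]
      show "(\<Sum>j<N. - rt_coeff j * (1 - y t ^ j)) \<le> \<bar>s t\<bar> / sqrt c"
        using sums_unique[OF sums] by (simp add: sqrt_y)
    qed (use int_gap int_s in auto)
    finally show "(\<Sum>j<N. - rt_coeff j * inner ?d ((1 - X ^ j) \<cdot> ?d)) \<le> (\<integral>t. \<bar>s t\<bar> / sqrt c \<partial>\<rho>)" .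
  qed
  then have "sqrt c * inner ?d (sqrt_1m X \<cdot> ?d) \<le> (\<integral>t. \<bar>s t\<bar> \<partial>\<rho>)"
    using c by (simp add: field_simps)
  then show ?thesis
    by (simp add: op_abs_def op_sqrt_def X_def c_def s_def)
qed

section \<open>Jacobi matrices and diagonal operators\<close>

text \<open>The two off-diagonal sums are exchanged by the shift of the summation index.\<close>
lemma jacobi_symmetric_form:
  assumes a: "bounded (range a)" and b: "bounded (range b)"
  shows "cinner (jacobi a b u) v = cinner u (jacobi a b v)"
proof -
  define f where "f n = cnj (coord u n) * (of_real (a n) * coord v (n + 1))" for n
  define g where "g n = cnj (coord u n) * (of_real (b n) * coord v n)" for n
  define h where "h n = cnj (of_real (a n) * coord u (n + 1)) * coord v n" for n
  note sq = square_summable_mult square_summable_bounded_mult square_summable_shift square_summable_coord a b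
  have f: "f summable_on UNIV" and g: "g summable_on UNIV" and h: "h summable_on UNIV"
    unfolding f_def g_def h_def by (intro sq)+
  have bij: "bij (\<lambda>n :: int. n - 1)"
    by (rule bij_betw_byWitness[where f' = "\<lambda>n. n + 1"]) auto
  note shift = summable_on_reindex_bij_betw[OF bij] infsum_reindex_bij_betw[OF bij]
  have f': "(\<lambda>n. f (n - 1)) summable_on UNIV" and h': "(\<lambda>n. h (n - 1)) summable_on UNIV"
    using shift(1)[of f] shift(1)[of h] f h by simp_all
  have "cinner (jacobi a b u) v = (\<Sum>\<^sub>\<infinity>n. f (n - 1) + g n + h n)"
    unfolding cinner_def by (intro infsum_cong) (simp add: coord_jacobi[OF a b] f_def g_def h_def algebra_simps)
  also have "\<dots> = (\<Sum>\<^sub>\<infinity>n. h (n - 1) + g n + f n)"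
    using f g h f' h' shift(2)[of f] shift(2)[of h] by (simp add: infsum_add summable_on_add)
  also have "\<dots> = cinner u (jacobi a b v)"
    unfolding cinner_def by (intro infsum_cong) (simp add: coord_jacobi[OF a b] f_def g_def h_def algebra_simps)
  finally show ?thesis .
qed

lemma diagonal_op_eigenvector:
  assumes "diagonal_op (app T)" "pos T"
  shows "T \<cdot> delta n = inner (delta n) (T \<cdot> delta n) *\<^sub>R delta n"
proof -
  have real: "cinner (delta n) (T \<cdot> delta n) = of_real (inner (delta n) (T \<cdot> delta n))"
    using assms(2) positive_op_app[of T] unfolding positive_op_def inner_ell2_def
    by (metis complex_is_Real_iff complex_nonneg_Reals_iff of_real_Re)
  have "coord (T \<cdot> delta n) m = coord (inner (delta n) (T \<cdot> delta n) *\<^sub>R delta n) m" for m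
    using assms(1) real
    by (cases "m = n") (auto simp: diagonal_op_def scaleR_ell2.rep_eq delta.rep_eq cinner_delta_left)
  then show ?thesis by (simp add: coord_inject[symmetric] fun_eq_iff)
qed

text \<open>For \<open>d > 0\<close> the vector \<open>y = (S - d\<^sup>1\<^sup>/\<^sup>2) u\<close> satisfies \<open>S y = - d\<^sup>1\<^sup>/\<^sup>2 y\<close>, which positivity of \<open>S\<close>
  permits only for \<open>y = 0\<close>.\<close>
lemma op_sqrt_eigenvector:
  assumes T: "pos T" and u: "T \<cdot> u = d *\<^sub>R u" and "d \<ge> 0"
  shows "op_sqrt T \<cdot> u = sqrt d *\<^sub>R u"
proof (cases "d = 0")
  case True
  then show ?thesis using norm_app_op_sqrt[OF T, of u] u by simp
next
  case False
  let ?S = "op_sqrt T"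
  define y where "y = ?S \<cdot> u - sqrt d *\<^sub>R u"
  have "?S \<cdot> ?S \<cdot> u = d *\<^sub>R u" using op_sqrt_square[OF T] u by (metis app_simps(3))
  then have "?S \<cdot> y = - (sqrt d *\<^sub>R y)"
    using assms(3) by (simp add: y_def scaleR_diff_right)
  then have "sqrt d * inner y y \<le> 0"
    using posD[OF pos_op_sqrt[OF T], of y] by simp
  then have "inner y y \<le> 0" using False assms(3) by (simp add: mult_le_0_iff)
  then have "y = 0" by (metis inner_eq_zero_iff inner_ge_zero order_antisym)
  then show ?thesis by (simp add: y_def)
qed

lemma sum_le_ennreal_infsum:
  fixes f :: "'i \<Rightarrow> ennreal"
  assumes "finite F"
  shows "(\<Sum>n\<in>F. f n) \<le> (\<Sum>\<^sub>\<infinity>n. f n)"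
  unfolding nonneg_infsum_complete[of UNIV f, simplified]
  by (rule SUP_upper) (simp add: assms)

theorem theorem2p1:
  fixes D :: "int ell2 \<Rightarrow> int ell2"
    and a b :: "int \<Rightarrow> real"
    and J :: "int ell2 \<Rightarrow> int ell2"
    and \<rho> :: "int \<Rightarrow> real measure"
    and E :: "real set"
    and x :: real
  assumes "diagonal_op D" and "positive_op D" and "trace_class D"
    and "bounded (range a)" and "bounded (range b)" and "\<And>n. a n > 0"
    and "J = jacobi a b" and "selfadjoint_op J"
    and "E = real_spectrum J"
    and "\<And>n. is_spectral_measure J n (\<rho> n)"
    and "x \<notin> E"
  shows "trace_norm (sqrt_op D \<circ> resolvent J (complex_of_real x) \<circ> sqrt_op D)
           \<le> trace_norm D * (SUP n. \<integral>\<^sup>+t\<in>E. ennreal (1 / \<bar>t - x\<bar>) \<partial>\<rho> n)"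
proof -
  define A where "A = op_of J"
  define T where "T = op_of D"
  have J: "J = app A"
    using assms(8) by (simp add: A_def app_op_of selfadjoint_op_def)
  have D: "D = app T"
    using assms(2) by (simp add: T_def app_op_of positive_op_def)
  have symA: "symmetric A"
    using jacobi_symmetric_form[OF assms(4,5)] unfolding symmetric_def J[symmetric] assms(7) inner_ell2_def
    by metis
  have posT: "pos T" using assms(2) by (simp add: D positive_op_app)
  have E: "E = real_spectrum (app A)" using assms(9) J by simp
  obtain R where R: "inverse_pair (A - x *\<^sub>R 1) R" "resolvent J (complex_of_real x) = app R"
    using inverse_pair_of_resolvent[of x A] assms(11) unfolding E J real_spectrum_def by auto
  have symR: "symmetric R"
    by (rule symmetric_inverse[OF _ R(1)]) (intro symmetric_algebra symA)
  define S where "S = op_sqrt T"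
  define K where "K = op_sqrt (op_abs R)"
  define d where "d n = inner (delta n) (T \<cdot> delta n)" for n
  define C where "C = (SUP n. \<integral>\<^sup>+t\<in>E. ennreal (1 / \<bar>t - x\<bar>) \<partial>\<rho> n)"
  have symS: "symmetric S" unfolding S_def by (intro pos_symmetric pos_op_sqrt posT)
  have d: "0 \<le> d n" for n unfolding d_def by (rule posD[OF posT])
  have Sd: "S \<cdot> delta n = sqrt (d n) *\<^sub>R delta n" for n
    unfolding S_def
    by (rule op_sqrt_eigenvector[OF posT _ d])
       (use diagonal_op_eigenvector[OF assms(1)[unfolded D] posT, of n] in \<open>simp add: d_def\<close>)
  have KS: "(norm ((K * S) \<cdot> delta n))\<^sup>2 = d n * inner (delta n) (op_abs R \<cdot> delta n)" for n
    using d[of n] norm_app_op_sqrt[OF pos_op_abs[OF symR], of "delta n"]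
    by (simp add: K_def Sd power_mult_distrib)
  have diag: "ennreal (inner (delta n) (op_abs R \<cdot> delta n)) \<le> C" for n
  proof -
    have sp: "is_spectral_measure (app A) n (\<rho> n)" using assms(10)[of n] J by simp
    then have sets [measurable_cong]: "sets (\<rho> n) = sets borel" and "finite_measure (\<rho> n)"
      by (auto simp: is_spectral_measure_def)
    interpret finite_measure "\<rho> n" by fact
    have [measurable]: "recip_on E x \<in> borel_measurable borel"
      unfolding E by (intro recip_on_measurable closed_real_spectrum)
    have bound: "\<bar>recip_on E x t\<bar> \<le> norm R" for t
      unfolding E by (rule recip_on_bound[OF R(1)])
    have int: "integrable (\<rho> n) (\<lambda>t. \<bar>recip_on E x t\<bar>)"
      by (rule integrable_const_bound[where B = "norm R"]) (simp_all add: bound)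
    have "ennreal (inner (delta n) (op_abs R \<cdot> delta n)) \<le> ennreal (\<integral>t. \<bar>recip_on E x t\<bar> \<partial>\<rho> n)"
      unfolding E by (rule ennreal_leI[OF op_abs_resolvent_diag_le[OF R(1) symR sp]])
    also have "\<dots> = (\<integral>\<^sup>+t. ennreal \<bar>recip_on E x t\<bar> \<partial>\<rho> n)"
      by (rule nn_integral_eq_integral[symmetric, OF int]) simp
    also have "\<dots> = (\<integral>\<^sup>+t\<in>E. ennreal (1 / \<bar>t - x\<bar>) \<partial>\<rho> n)"
      by (intro nn_integral_cong) (simp add: recip_on_def indicator_def)
    also have "\<dots> \<le> C" unfolding C_def by (rule SUP_upper) simp
    finally show ?thesis .
  qed
  have "op_abs T = T"
    unfolding op_abs_def
    by (rule pos_sqrt_unique[OF pos_square[OF pos_symmetric[OF posT]] posT refl, symmetric])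
  then have trD: "trace_norm D = (\<Sum>\<^sub>\<infinity>n. ennreal (d n))"
    by (simp add: D trace_norm_app pos_symmetric[OF posT] d_def)
  have op: "sqrt_op D \<circ> resolvent J (complex_of_real x) \<circ> sqrt_op D = app (S * R * S)"
    by (simp add: D sqrt_op_app[OF posT] R(2) S_def fun_eq_iff)
  have "trace_norm (app (S * R * S)) \<le> trace_norm D * C"
  proof (cases "trace_norm D * C")
    case (real h)
    have "hs_le (K * S) h"
      unfolding hs_le_def
    proof (intro allI impI)
      fix F :: "int set" assume F: "finite F"
      have "ennreal (\<Sum>n\<in>F. (norm ((K * S) \<cdot> delta n))\<^sup>2)
          = (\<Sum>n\<in>F. ennreal (d n) * ennreal (inner (delta n) (op_abs R \<cdot> delta n)))"
        using d posD[OF pos_op_abs[OF symR]] by (simp only: KS) (simp add: ennreal_mult flip: sum_ennreal)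
      also have "\<dots> \<le> (\<Sum>n\<in>F. ennreal (d n)) * C"
        unfolding sum_distrib_right by (intro sum_mono mult_left_mono diag) simp
      also have "\<dots> \<le> trace_norm D * C"
        unfolding trD by (intro mult_right_mono sum_le_ennreal_infsum F) simp
      finally show "(\<Sum>n\<in>F. (norm ((K * S) \<cdot> delta n))\<^sup>2) \<le> h"
        using real by simp
    qed
    then show ?thesis
      using trace_norm_sandwich_le[OF symR symS] real unfolding K_def by simp
  qed simp
  then show ?thesis unfolding op C_def .
qed

end
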